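(* Let $K$ be a commutative ring with identity and let $q$ be an invertible element of $K$. In the tower of affine Hecke algebras $$H\tilde A_1(q)\xrightarrow{HR_2}H\tilde A_2(q)\xrightarrow{HR_3}\cdots\longrightarrow H\tilde A_{n-1}(q)\xrightarrow{HR_n}H\tilde A_n(q)\longrightarrow\cdots$$ every arrow is faithful, i.e. for every $n\ge2$ the $K$-algebra homomorphism $HR_n$ is injective.
   Context: For $n\ge 2$, $W(\tilde A_n)$ is the affine Coxeter group with generators $S_n=\{\sigma_1,\dots,\sigma_n,a_{n+1}\}$ whose Coxeter diagram is the $(n+1)$-cycle $\sigma_1-\sigma_2-\cdots-\sigma_n-a_{n+1}-\sigma_1$ (all edges of order 3); $W(\tilde A_1)$ is the infinite dihedral group with generators $S_1=\{\sigma_1,a_2\}$. $l$ is Coxeter length and $\mathscr L(w)=\{s\in S_n: l(sw)<l(w)\}$. The Hecke algebra $H\tilde A_n(q)$ is the free $K$-module with basis $\{g_w: w\in W(\tilde A_n)\}$ with the unique $K$-algebra structure such that for $s\in S_n$: $g_sg_w=g_{sw}$ if $s\notin\mathscr L(w)$, and $g_sg_w=q\,g_{sw}+(q-1)g_w$ if $s\in\mathscr L(w)$. The elements $g_s$, $s\in S_n$, are invertible. Writing $e_w$ for the basis elements of $H\tilde A_{n-1}(q)$ and $g_w$ for those of $H\tilde A_n(q)$, $HR_n:H\tilde A_{n-1}(q)\to H\tilde A_n(q)$ is the $K$-algebra homomorphism determined by $e_{\sigma_i}\mapsto g_{\sigma_i}$ for $1\le i\le n-1$ and $e_{a_n}\mapsto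 g_{\sigma_n}g_{a_{n+1}}g_{\sigma_n}^{-1}$. *)

theory Defs
  imports "HOL-Library.Poly_Mapping" "HOL-Algebra.Ring"
begin

section \<open>Coxeter groups\<close>

text \<open>
  The Coxeter group of a Coxeter matrix \<open>m\<close> on a set \<open>S\<close> is the group with generators \<open>S\<close> and
  relations \<open>(s t)^(m s t) = 1\<close>. Since \<open>m s s = 1\<close> makes the generators involutions, it is the
  quotient of the monoid of words over \<open>S\<close> by the congruence generated by these relations. The value
  \<open>m s t = 0\<close> stands for infinite order: it yields the trivial relation \<open>[] ~ []\<close>.
\<close>

inductive coxeter_cong :: "'s set \<Rightarrow> ('s \<Rightarrow> 's \<Rightarrow> nat) \<Rightarrow> 's list \<Rightarrow> 's list \<Rightarrow> bool"
  for S :: "'s set" and m :: "'s \<Rightarrow> 's \<Rightarrow> nat" where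
  relator: "u \<in> lists S \<Longrightarrow> v \<in> lists S \<Longrightarrow> s \<in> S \<Longrightarrow> t \<in> S \<Longrightarrow>
    coxeter_cong S m (u @ concat (replicate (m s t) [s, t]) @ v) (u @ v)"
| refl: "u \<in> lists S \<Longrightarrow> coxeter_cong S m u u"
| sym: "coxeter_cong S m u v \<Longrightarrow> coxeter_cong S m v u"
| trans: "coxeter_cong S m u v \<Longrightarrow> coxeter_cong S m v w \<Longrightarrow> coxeter_cong S m u w"

definition coxeter_rel :: "'s set \<Rightarrow> ('s \<Rightarrow> 's \<Rightarrow> nat) \<Rightarrow> 's list rel" where
  "coxeter_rel S m = {(u, v). coxeter_cong S m u v}"

definition word_class :: "'s set \<Rightarrow> ('s \<Rightarrow> 's \<Rightarrow> nat) \<Rightarrow> 's list \<Rightarrow> 's list set" where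
  "word_class S m u = coxeter_rel S m `` {u}"

definition coxeter_group :: "'s set \<Rightarrow> ('s \<Rightarrow> 's \<Rightarrow> nat) \<Rightarrow> 's list set monoid" where
  "coxeter_group S m =
    \<lparr>carrier = lists S // coxeter_rel S m,
     monoid.mult = (\<lambda>A B. \<Union>a\<in>A. \<Union>b\<in>B. word_class S m (a @ b)),
     one = word_class S m []\<rparr>"

abbreviation cox_gen :: "'s set \<Rightarrow> ('s \<Rightarrow> 's \<Rightarrow> nat) \<Rightarrow> 's \<Rightarrow> 's list set" where
  "cox_gen S m s \<equiv> word_class S m [s]"

text \<open>The elements of \<open>w\<close> are the words that represent it.\<close>

definition coxeter_length :: "'s list set \<Rightarrow> nat" where
  "coxeter_length w = (LEAST k. \<exists>u\<in>w. length u = k)"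

definition left_descents :: "'s set \<Rightarrow> ('s \<Rightarrow> 's \<Rightarrow> nat) \<Rightarrow> 's list set \<Rightarrow> 's set" where
  "left_descents S m w =
    {s \<in> S. coxeter_length (cox_gen S m s \<otimes>\<^bsub>coxeter_group S m\<^esub> w) < coxeter_length w}"

lemma coxeter_cong_lists: "coxeter_cong S m u v \<Longrightarrow> u \<in> lists S \<and> v \<in> lists S"
  by (induction rule: coxeter_cong.induct) (auto split: if_splits)

lemma coxeter_cong_context:
  "coxeter_cong S m u v \<Longrightarrow> a \<in> lists S \<Longrightarrow> b \<in> lists S \<Longrightarrow>
    coxeter_cong S m (a @ u @ b) (a @ v @ b)"
proof (induction rule: coxeter_cong.induct)
  case (relator u v s t)
  then show ?case
    using coxeter_cong.relator[of "a @ u" S "v @ b" s t m] by simp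
next
  case (refl u)
  then show ?case
    by (simp add: coxeter_cong.refl)
next
  case (sym u v)
  then show ?case
    by (simp add: coxeter_cong.sym)
next
  case (trans u v w)
  then show ?case
    using coxeter_cong.trans[of S m "a @ u @ b" "a @ v @ b" "a @ w @ b"] by simp
qed

lemma coxeter_cong_append:
  assumes "coxeter_cong S m u u'" "coxeter_cong S m v v'"
  shows "coxeter_cong S m (u @ v) (u' @ v')"
proof (rule coxeter_cong.trans)
  show "coxeter_cong S m (u @ v) (u' @ v)"
    using coxeter_cong_context[OF assms(1), of "[]" v] coxeter_cong_lists[OF assms(2)] by simp
  show "coxeter_cong S m (u' @ v) (u' @ v')"
    using coxeter_cong_context[OF assms(2), of u' "[]"] coxeter_cong_lists[OF assms(1)] by simp
qed

lemma equiv_coxeter_rel: "equiv (lists S) (coxeter_rel S m)"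
proof (rule equivI)
  show "coxeter_rel S m \<subseteq> lists S \<times> lists S"
    by (auto simp: coxeter_rel_def dest: coxeter_cong_lists)
  show "refl_on (lists S) (coxeter_rel S m)"
    by (rule refl_onI) (simp add: coxeter_rel_def coxeter_cong.refl)
  show "sym (coxeter_rel S m)"
    by (rule symI) (simp add: coxeter_rel_def coxeter_cong.sym)
  show "trans (coxeter_rel S m)"
    by (rule transI) (unfold coxeter_rel_def mem_Collect_eq case_prod_conv, rule coxeter_cong.trans)
qed

lemma word_class_eq_iff:
  "u \<in> lists S \<Longrightarrow> v \<in> lists S \<Longrightarrow> word_class S m u = word_class S m v \<longleftrightarrow> coxeter_cong S m u v"
  unfolding word_class_def
  by (subst eq_equiv_class_iff[OF equiv_coxeter_rel]) (simp_all add: coxeter_rel_def)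

lemma carrier_coxeter_group: "carrier (coxeter_group S m) = word_class S m ` lists S"
  by (auto simp: coxeter_group_def word_class_def quotient_def)

lemma word_class_mult:
  assumes "u \<in> lists S" "v \<in> lists S"
  shows "word_class S m u \<otimes>\<^bsub>coxeter_group S m\<^esub> word_class S m v = word_class S m (u @ v)"
proof -
  have "word_class S m (a @ b) = word_class S m (u @ v)"
    if "a \<in> word_class S m u" "b \<in> word_class S m v" for a b
  proof -
    have "coxeter_cong S m (u @ v) (a @ b)"
      using that by (intro coxeter_cong_append) (auto simp: word_class_def coxeter_rel_def)
    then show ?thesis
      using word_class_eq_iff[of "a @ b" S "u @ v" m] coxeter_cong_lists[of S m "u @ v" "a @ b"]
        coxeter_cong.sym[of S m "u @ v" "a @ b"] by simp
  qed
  moreover have "u \<in> word_class S m u" "v \<in> word_class S m v"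
    using assms by (auto simp: word_class_def coxeter_rel_def intro: coxeter_cong.refl)
  ultimately have "(\<Union>a\<in>word_class S m u. \<Union>b\<in>word_class S m v. word_class S m (a @ b)) =
      word_class S m (u @ v)"
    by blast
  then show ?thesis
    by (simp add: coxeter_group_def)
qed

lemma group_coxeter_group:
  assumes "\<And>s. s \<in> S \<Longrightarrow> m s s = 1"
  shows "group (coxeter_group S m)"
proof (rule groupI)
  let ?G = "coxeter_group S m"
  have one_eq: "\<one>\<^bsub>?G\<^esub> = word_class S m []"
    by (simp add: coxeter_group_def)
  have word: "\<exists>u \<in> lists S. x = word_class S m u" if "x \<in> carrier ?G" for x
    using that unfolding carrier_coxeter_group by blast
  have closed: "word_class S m u \<in> carrier ?G" if "u \<in> lists S" for u
    using that unfolding carrier_coxeter_group by blast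
  show "\<one>\<^bsub>?G\<^esub> \<in> carrier ?G"
    unfolding one_eq by (rule closed) simp
  show "x \<otimes>\<^bsub>?G\<^esub> y \<in> carrier ?G" if x: "x \<in> carrier ?G" and y: "y \<in> carrier ?G" for x y
  proof -
    obtain u v where "u \<in> lists S" "x = word_class S m u" "v \<in> lists S" "y = word_class S m v"
      using word[OF x] word[OF y] by blast
    then show ?thesis
      using closed[of "u @ v"] by (simp add: word_class_mult)
  qed
  show "x \<otimes>\<^bsub>?G\<^esub> y \<otimes>\<^bsub>?G\<^esub> z = x \<otimes>\<^bsub>?G\<^esub> (y \<otimes>\<^bsub>?G\<^esub> z)"
    if x: "x \<in> carrier ?G" and y: "y \<in> carrier ?G" and z: "z \<in> carrier ?G" for x y z
  proof -
    obtain u v w where "u \<in> lists S" "x = word_class S m u" "v \<in> lists S" "y = word_class S m v"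
        "w \<in> lists S" "z = word_class S m w"
      using word[OF x] word[OF y] word[OF z] by blast
    then show ?thesis
      by (simp add: word_class_mult)
  qed
  show "\<one>\<^bsub>?G\<^esub> \<otimes>\<^bsub>?G\<^esub> x = x" if x: "x \<in> carrier ?G" for x
    using word[OF x] word_class_mult[of "[]" S _ m] by (auto simp: one_eq)
  have rev_lists: "rev u \<in> lists S" if "u \<in> lists S" for u
    using that by (simp add: lists_eq_set)
  have inv: "coxeter_cong S m (rev u @ u) []" if "u \<in> lists S" for u
    using that
  proof (induction u)
    case (Cons s u)
    then have "coxeter_cong S m (rev u @ [s, s] @ u) (rev u @ u)"
      using coxeter_cong.relator[of "rev u" S u s s m] assms rev_lists[of u] by simp
    moreover have "coxeter_cong S m (rev u @ u) []"
      using Cons by simp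
    ultimately have "coxeter_cong S m (rev u @ [s, s] @ u) []"
      by (rule coxeter_cong.trans)
    then show ?case
      by simp
  qed (simp add: coxeter_cong.refl)
  show "\<exists>y\<in>carrier ?G. y \<otimes>\<^bsub>?G\<^esub> x = \<one>\<^bsub>?G\<^esub>" if x: "x \<in> carrier ?G" for x
  proof -
    obtain u where u: "u \<in> lists S" "x = word_class S m u"
      using word[OF x] by blast
    then have v: "rev u \<in> lists S"
      by (simp only: rev_lists)
    have "word_class S m (rev u) \<otimes>\<^bsub>?G\<^esub> x = word_class S m (rev u @ u)"
      using u v by (simp add: word_class_mult)
    also have "\<dots> = \<one>\<^bsub>?G\<^esub>"
      using u v inv[of u] by (simp add: one_eq word_class_eq_iff)
    finally show ?thesis
      using closed[OF v] by blast
  qed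
qed

section \<open>Hecke algebras\<close>

text \<open>
  The free module over the coefficient ring with basis \<open>W\<close> consists of the finitely supported
  functions with support in \<open>W\<close>; the basis element \<open>g_w\<close> is \<open>hbasis w\<close>. An algebra structure on it is
  a ring record whose additive part is the one of the module and whose multiplication is bilinear.
\<close>

definition scale :: "'k::comm_ring_1 \<Rightarrow> ('w \<Rightarrow>\<^sub>0 'k) \<Rightarrow> ('w \<Rightarrow>\<^sub>0 'k)" where
  "scale c x = Poly_Mapping.map ((*) c) x"

definition hbasis :: "'w \<Rightarrow> ('w \<Rightarrow>\<^sub>0 'k::comm_ring_1)" where
  "hbasis w = Poly_Mapping.single w 1"

locale hecke_algebra = ring H
  for S :: "'s set" and m :: "'s \<Rightarrow> 's \<Rightarrow> nat" and q :: "'k::comm_ring_1"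
    and H :: "('s list set \<Rightarrow>\<^sub>0 'k) ring" (structure) +
  assumes carrier_eq: "carrier H = {x. Poly_Mapping.keys x \<subseteq> carrier (coxeter_group S m)}"
    and zero_eq: "\<zero> = 0"
    and add_eq: "x \<in> carrier H \<Longrightarrow> y \<in> carrier H \<Longrightarrow> x \<oplus> y = x + y"
    and scale_left: "x \<in> carrier H \<Longrightarrow> y \<in> carrier H \<Longrightarrow> scale c x \<otimes> y = scale c (x \<otimes> y)"
    and scale_right: "x \<in> carrier H \<Longrightarrow> y \<in> carrier H \<Longrightarrow> x \<otimes> scale c y = scale c (x \<otimes> y)"
    and mult_ascent: "s \<in> S \<Longrightarrow> w \<in> carrier (coxeter_group S m) \<Longrightarrow> s \<notin> left_descents S m w \<Longrightarrow>
      hbasis (cox_gen S m s) \<otimes> hbasis w = hbasis (cox_gen S m s \<otimes>\<^bsub>coxeter_group S m\<^esub> w)"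
    and mult_descent: "s \<in> S \<Longrightarrow> w \<in> carrier (coxeter_group S m) \<Longrightarrow> s \<in> left_descents S m w \<Longrightarrow>
      hbasis (cox_gen S m s) \<otimes> hbasis w =
        scale q (hbasis (cox_gen S m s \<otimes>\<^bsub>coxeter_group S m\<^esub> w)) + scale (q - 1) (hbasis w)"

definition algebra_hom ::
  "('v \<Rightarrow>\<^sub>0 'k::comm_ring_1) ring \<Rightarrow> ('w \<Rightarrow>\<^sub>0 'k) ring \<Rightarrow> (('v \<Rightarrow>\<^sub>0 'k) \<Rightarrow> ('w \<Rightarrow>\<^sub>0 'k)) set" where
  "algebra_hom H H' = {h \<in> ring_hom H H'. \<forall>c. \<forall>x\<in>carrier H. h (scale c x) = scale c (h x)}"

section \<open>The affine type A tower\<close>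

text \<open>\<open>Sig i\<close> is the generator \<open>\<sigma>_i\<close> and \<open>Aff (n + 1)\<close> is the affine generator \<open>a_(n+1)\<close>.\<close>

datatype affA_gen = Sig nat | Aff nat

definition affA_gens :: "nat \<Rightarrow> affA_gen set" where
  "affA_gens n = Sig ` {1..n} \<union> {Aff (n + 1)}"

fun affA_adjacent :: "nat \<Rightarrow> affA_gen \<Rightarrow> affA_gen \<Rightarrow> bool" where
  "affA_adjacent n (Sig i) (Sig j) \<longleftrightarrow> j = i + 1 \<or> i = j + 1"
| "affA_adjacent n (Sig i) (Aff _) \<longleftrightarrow> i = 1 \<or> i = n"
| "affA_adjacent n (Aff _) (Sig i) \<longleftrightarrow> i = 1 \<or> i = n"
| "affA_adjacent n (Aff _) (Aff _) \<longleftrightarrow> False"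

text \<open>For \<open>n = 1\<close> the group is the infinite dihedral group, hence the value \<open>0\<close> (infinite order).\<close>

definition affA_matrix :: "nat \<Rightarrow> affA_gen \<Rightarrow> affA_gen \<Rightarrow> nat" where
  "affA_matrix n s t =
    (if s = t then 1 else if affA_adjacent n s t then (if n = 1 then 0 else 3) else 2)"

locale affA_hecke_algebra = hecke_algebra "affA_gens n" "affA_matrix n" q H
  for n :: nat and q :: "'k::comm_ring_1" and H :: "(affA_gen list set \<Rightarrow>\<^sub>0 'k) ring" (structure)

definition affA_T :: "nat \<Rightarrow> affA_gen \<Rightarrow> (affA_gen list set \<Rightarrow>\<^sub>0 'k::comm_ring_1)" where
  "affA_T n s = hbasis (cox_gen (affA_gens n) (affA_matrix n) s)"

text \<open>
  \<open>h\<close> is the map \<open>HR_n\<close>, from the algebra \<open>H\<close> of rank \<open>n - 1\<close> to the algebra \<open>H'\<close> of rank \<open>n\<close>.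
  It is unique since the \<open>g_s\<close> generate the algebra when \<open>q\<close> is invertible.
\<close>

definition is_HR :: "nat \<Rightarrow> (affA_gen list set \<Rightarrow>\<^sub>0 'k::comm_ring_1) ring \<Rightarrow>
    (affA_gen list set \<Rightarrow>\<^sub>0 'k) ring \<Rightarrow>
    ((affA_gen list set \<Rightarrow>\<^sub>0 'k) \<Rightarrow> (affA_gen list set \<Rightarrow>\<^sub>0 'k)) \<Rightarrow> bool" where
  "is_HR n H H' h \<longleftrightarrow>
    h \<in> algebra_hom H H' \<and>
    (\<forall>i\<in>{1..n - 1}. h (affA_T (n - 1) (Sig i)) = affA_T n (Sig i)) \<and>
    h (affA_T (n - 1) (Aff n)) =
      affA_T n (Sig n) \<otimes>\<^bsub>H'\<^esub> affA_T n (Aff (n + 1)) \<otimes>\<^bsub>H'\<^esub> inv\<^bsub>H'\<^esub> (affA_T n (Sig n))"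

end

theory Submission
  imports Defs
begin

text \<open>
  Let \<open>R\<close> be the group homomorphism from the group of rank \<open>n - 1\<close> to the group of rank \<open>n\<close> that
  underlies \<open>HR_n\<close>: it fixes \<open>\<sigma>_1, ..., \<sigma>_(n-1)\<close> and sends \<open>a_n\<close> to \<open>\<sigma>_n a_(n+1) \<sigma>_n\<close>. The algebra map
  is triangular over \<open>R\<close>: the image of the basis element \<open>e_w\<close> is a unit multiple of \<open>g_(R w)\<close> plus a
  combination of elements \<open>g_z\<close> with \<open>z\<close> strictly shorter than \<open>R w\<close> (\<open>leading_h_basis\<close>). Since \<open>R\<close>
  is injective, this gives injectivity of \<open>HR_n\<close> over every coefficient ring: if \<open>w\<close> lies in the support
  of \<open>x\<close> and \<open>R w\<close> is as long as possible, the coefficient of \<open>g_(R w)\<close> in the image of \<open>x\<close> is a unit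
  times the coefficient of \<open>e_w\<close> in \<open>x\<close>, hence it is not zero.

  For triangularity one strips left descents of \<open>w\<close>. A descent \<open>\<sigma>_i\<close> of \<open>w\<close> is also a descent of \<open>R w\<close>,
  so multiplication by \<open>g_(\<sigma>_i)\<close> moves the leading term as it should. A descent \<open>a_n\<close> is more delicate:
  its image involves three generators of the larger group, and passing from \<open>a_n w\<close> to \<open>w\<close> need not
  lengthen the image by three. It does so whenever no \<open>\<sigma>_i\<close> is a descent of \<open>w\<close>
  (\<open>minimal_coset_falls\<close>), and \<open>a_n\<close> is stripped only in that case. The factor \<open>g_(\<sigma>_n)\<^sup>-\<^sup>1\<close>
  is \<open>q\<^sup>-\<^sup>1 g_(\<sigma>_n)\<close> plus a scalar, so it acts on leading terms like \<open>g_(\<sigma>_n)\<close>, up to a unit.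

  The statements about descents and about \<open>R\<close> are read off from affine permutations, that is, bijections
  \<open>u\<close> of the integers with \<open>u (x + p) = u x + p\<close>: a generator swaps the values at two neighbouring
  positions (modulo \<open>p\<close>), it is a descent if those values decrease, and \<open>R\<close> inserts one fixed residue
  class into the permutation. This requires that affine permutations represent the abstractly presented
  Coxeter group faithfully and that Coxeter length is governed by these descents. Both follow from a
  diamond argument (\<open>climbing_unique\<close>), stated for an arbitrary Coxeter matrix and an action
  on a set with a notion of descent.
\<close>

section \<open>Coxeter groups acting with descents\<close>

text \<open>
  A criterion for faithfulness. Words act on \<open>X\<close> from a base point, every descent step lowers a natural
  number, and only the base point has no descents. The last assumption is the local confluence
  condition: two different descents of \<open>x\<close> generate a finite dihedral group and the state can be
  lowered along the whole of each of its two reduced words, not only along the first letter.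
\<close>

locale coxeter_descent_action =
  fixes S :: "'s set" and m :: "'s \<Rightarrow> 's \<Rightarrow> nat"
    and X :: "'x set" and act :: "'s \<Rightarrow> 'x \<Rightarrow> 'x" and base :: 'x
    and desc :: "'s \<Rightarrow> 'x \<Rightarrow> bool" and height :: "'x \<Rightarrow> nat"
  assumes m_diag: "s \<in> S \<Longrightarrow> m s s = 1"
    and m_sym: "s \<in> S \<Longrightarrow> t \<in> S \<Longrightarrow> m s t = m t s"
    and base_X: "base \<in> X"
    and act_X: "s \<in> S \<Longrightarrow> x \<in> X \<Longrightarrow> act s x \<in> X"
    and act_relator: "s \<in> S \<Longrightarrow> t \<in> S \<Longrightarrow> x \<in> X \<Longrightarrow>
      foldr act (concat (replicate (m s t) [s, t])) x = x"
    and desc_act: "s \<in> S \<Longrightarrow> x \<in> X \<Longrightarrow> desc s (act s x) \<longleftrightarrow> \<not> desc s x"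
    and height_desc: "s \<in> S \<Longrightarrow> x \<in> X \<Longrightarrow> desc s x \<Longrightarrow> height (act s x) < height x"
    and desc_base: "s \<in> S \<Longrightarrow> \<not> desc s base"
    and no_desc_base: "x \<in> X \<Longrightarrow> (\<And>s. s \<in> S \<Longrightarrow> \<not> desc s x) \<Longrightarrow> x = base"
    and desc_pair: "s \<in> S \<Longrightarrow> t \<in> S \<Longrightarrow> x \<in> X \<Longrightarrow> s \<noteq> t \<Longrightarrow> desc s x \<Longrightarrow> desc t x \<Longrightarrow>
      m s t = 2 \<and> desc t (act s x) \<or>
      m s t = 3 \<and> desc t (act s x) \<and> desc s (act t (act s x))"
begin

abbreviation cong_words (infix "\<sim>" 50) where
  "u \<sim> v \<equiv> coxeter_cong S m u v"

definition state :: "'s list \<Rightarrow> 'x" where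
  "state w = foldr act w base"

lemma state_simps [simp]: "state [] = base" "state (s # w) = act s (state w)"
  by (simp_all add: state_def)

lemma foldr_act_X: "w \<in> lists S \<Longrightarrow> x \<in> X \<Longrightarrow> foldr act w x \<in> X"
  by (induction w) (auto intro: act_X)

lemma state_X: "w \<in> lists S \<Longrightarrow> state w \<in> X"
  by (simp add: state_def foldr_act_X base_X)

lemma act_act: "s \<in> S \<Longrightarrow> x \<in> X \<Longrightarrow> act s (act s x) = x"
  using act_relator[of s s x] by (simp add: m_diag)

lemma state_cong: "u \<sim> v \<Longrightarrow> state u = state v"
proof (induction rule: coxeter_cong.induct)
  case (relator u v s t)
  then show ?case
    using act_relator[OF relator(3,4) state_X[OF relator(2)]] by (simp add: state_def)
qed auto

lemma cong_Cons: "s \<in> S \<Longrightarrow> u \<sim> v \<Longrightarrow> s # u \<sim> s # v"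
  using coxeter_cong_context[of S m u v "[s]" "[]"] by simp

lemma cancel_cong:
  assumes "s \<in> S" "u \<in> lists S" "v \<in> lists S"
  shows "u @ s # s # v \<sim> u @ v"
  using coxeter_cong.relator[OF assms(2,3,1,1), of m] by (simp add: m_diag assms)

lemma commute_cong:
  assumes "s \<in> S" "t \<in> S" "c \<in> lists S" "m s t = 2"
  shows "s # t # c \<sim> t # s # c"
proof -
  have "[s, t, s, t] @ t # s # c \<sim> t # s # c"
    using coxeter_cong.relator[of "[]" S "t # s # c" s t m] assms by (simp add: numeral_2_eq_2)
  moreover have "[s, t, s] @ t # t # s # c \<sim> [s, t, s] @ s # c"
    using assms by (intro cancel_cong) auto
  moreover have "[s, t] @ s # s # c \<sim> [s, t] @ c"
    using assms by (intro cancel_cong) auto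
  ultimately show ?thesis
    by (simp, meson coxeter_cong.sym coxeter_cong.trans)
qed

lemma braid_cong:
  assumes "s \<in> S" "t \<in> S" "c \<in> lists S" "m s t = 3"
  shows "s # t # s # c \<sim> t # s # t # c"
proof -
  have "[s, t, s, t, s, t] @ t # s # t # c \<sim> t # s # t # c"
    using coxeter_cong.relator[of "[]" S "t # s # t # c" s t m] assms
    by (simp add: numeral_3_eq_3)
  moreover have "[s, t, s, t, s] @ t # t # s # t # c \<sim> [s, t, s, t, s] @ s # t # c"
    using assms by (intro cancel_cong) auto
  moreover have "[s, t, s, t] @ s # s # t # c \<sim> [s, t, s, t] @ t # c"
    using assms by (intro cancel_cong) auto
  moreover have "[s, t, s] @ t # t # c \<sim> [s, t, s] @ c"
    using assms by (intro cancel_cong) auto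
  ultimately show ?thesis
    by (simp, meson coxeter_cong.sym coxeter_cong.trans)
qed

text \<open>
  Words all of whose letters raise the state, read from right to left. They turn out to be exactly the
  reduced words, but are accessible without any knowledge of Coxeter length.
\<close>

primrec climbing :: "'s list \<Rightarrow> bool" where
  "climbing [] \<longleftrightarrow> True"
| "climbing (s # w) \<longleftrightarrow> s \<in> S \<and> climbing w \<and> \<not> desc s (state w)"

lemma climbing_lists: "climbing w \<Longrightarrow> w \<in> lists S"
  by (induction w) auto

lemma climbing_exists:
  assumes "w \<in> lists S"
  shows "\<exists>c. climbing c \<and> state c = state w"
  using assms
proof (induction "height (state w)" arbitrary: w rule: less_induct)
  case less
  show ?case
  proof (cases "\<exists>s\<in>S. desc s (state w)")
    case True
    then obtain s where s: "s \<in> S" "desc s (state w)" by blast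
    have "\<exists>c. climbing c \<and> state c = state (s # w)"
      using less.prems s by (intro less.hyps) (auto intro: height_desc state_X)
    then obtain c where c: "climbing c" "state c = act s (state w)" by auto
    then have "climbing (s # c)" "state (s # c) = state w"
      using s less.prems by (simp_all add: desc_act state_X act_act)
    then show ?thesis by blast
  next
    case False
    then have "state w = base"
      using no_desc_base[OF state_X[OF less.prems]] by blast
    then show ?thesis
      by (intro exI[of _ "[]"]) simp
  qed
qed

lemma climbing_Cons_desc:
  assumes "climbing (s # w)"
  shows "desc s (state (s # w))" "act s (state (s # w)) = state w"
  using assms climbing_lists[of w] by (simp_all add: desc_act act_act state_X)

text \<open>
  The diamond argument: two climbing words for the same state are congruent and equally long. If their
  first letters \<open>s\<close> and \<open>t\<close> differ, both are descents of the state; going down along the longest element of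
  the dihedral group generated by \<open>s\<close> and \<open>t\<close> reaches one common lower state, and a climbing word \<open>c\<close> for
  it can be continued in two ways, related by a single commutation or braid relation. By induction each
  continuation is congruent to one of the given words.
\<close>

lemma climbing_unique:
  assumes "climbing a" "climbing b" "state a = state b"
  shows "a \<sim> b \<and> length a = length b"
  using assms
proof (induction "height (state a)" arbitrary: a b rule: less_induct)
  case less
  define x where "x = state a"
  have xb: "state b = x" using less.prems by (simp add: x_def)
  have xX: "x \<in> X" unfolding x_def using less.prems by (intro state_X climbing_lists)
  show ?case
  proof (cases a)
    case Nil
    have "b = []"
    proof (cases b)
      case (Cons t b')
      then have "t \<in> S" "desc t base"
        using climbing_Cons_desc(1)[of t b'] less.prems Nil by simp_all
      then show ?thesis using desc_base by blast
    qed simp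
    with Nil show ?thesis by (simp add: coxeter_cong.refl)
  next
    case a: (Cons s a')
    have s: "s \<in> S" "desc s x" "act s x = state a'" "climbing a'"
      using less.prems climbing_Cons_desc[of s a'] a by (simp_all add: x_def)
    obtain t b' where b: "b = t # b'"
      using s desc_base[of s] xb by (cases b) auto
    have t: "t \<in> S" "desc t x" "act t x = state b'" "climbing b'"
      using less.prems climbing_Cons_desc[of t b'] b xb by simp_all
    have IH: "c \<sim> d \<and> length c = length d"
      if "climbing c" "climbing d" "state c = state d" "height (state c) < height x" for c d
      using less.hyps[of c d] that by (simp add: x_def)
    have ha: "height (state a') < height x" "height (state b') < height x"
      using height_desc[OF s(1) xX s(2)] height_desc[OF t(1) xX t(2)] s(3) t(3) by simp_all
    show ?thesis
    proof (cases "s = t")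
      case True
      then have "a' \<sim> b' \<and> length a' = length b'"
        using IH[of a' b'] s t ha by simp
      then show ?thesis
        using a b True s cong_Cons by simp
    next
      case False
      have close: "s # a' \<sim> t # b' \<and> length (s # a') = length (t # b')"
        if "a' \<sim> c \<and> length a' = length c" "b' \<sim> d \<and> length b' = length d"
          "s # c \<sim> t # d" "length c = length d" for c d
      proof -
        have "s # a' \<sim> s # c" "t # d \<sim> t # b'"
          using that cong_Cons s(1) t(1) coxeter_cong.sym by blast+
        then have "s # a' \<sim> t # b'"
          using that(3) coxeter_cong.trans by meson
        with that show ?thesis by simp
      qed
      have pos: "act s x \<in> X" "act t x \<in> X" by (rule act_X[OF s(1) xX], rule act_X[OF t(1) xX])
      have ms: "m t s = m s t" using m_sym s t by simp
      consider "m s t = 2" "desc t (act s x)" "desc s (act t x)"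
        | "m s t = 3" "desc t (act s x)" "desc s (act t (act s x))"
          "desc s (act t x)" "desc t (act s (act t x))"
        using desc_pair[OF s(1) t(1) xX False s(2) t(2)]
          desc_pair[OF t(1) s(1) xX _ t(2) s(2)] False ms by auto
      then show ?thesis
      proof cases
        case 1
        have "foldr act (concat (replicate 2 [s, t])) x = x"
          using act_relator[OF s(1) t(1) xX] 1 by simp
        then have "act s (act t (act s (act t x))) = x" by (simp add: numeral_2_eq_2)
        then have eq: "act t (act s x) = act s (act t x)"
          by (metis act_act act_X s(1) t(1) xX)
        have "\<exists>c. climbing c \<and> state c = state (t # a')"
          using t s climbing_lists by (intro climbing_exists) simp
        then obtain c where c: "climbing c" "state c = act t (act s x)"
          using s by auto
        have tc: "climbing (t # c)" "state (t # c) = act s x"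
          using t(1) c 1 pos by (simp_all add: desc_act act_act)
        have sc: "climbing (s # c)" "state (s # c) = act t x"
          using s(1) c(1) c(2)[unfolded eq] 1 pos by (simp_all add: desc_act act_act)
        have "a' \<sim> t # c \<and> length a' = length (t # c)"
          using tc s ha by (intro IH) auto
        moreover have "b' \<sim> s # c \<and> length b' = length (s # c)"
          using sc t ha by (intro IH) auto
        moreover have "s # t # c \<sim> t # s # c"
          using s t c 1 by (intro commute_cong) (auto simp: climbing_lists)
        ultimately show ?thesis
          unfolding a b by (intro close[of "t # c" "s # c"]) simp_all
      next
        case 2
        have "foldr act (concat (replicate 3 [s, t])) x = x"
          using act_relator[OF s(1) t(1) xX] 2 by simp
        then have "act s (act t (act s (act t (act s (act t x))))) = x"
          by (simp add: numeral_3_eq_3)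
        then have eq: "act s (act t (act s x)) = act t (act s (act t x))"
          by (metis act_act act_X s(1) t(1) xX)
        have pos2: "act t (act s x) \<in> X" "act s (act t x) \<in> X"
          by (rule act_X[OF t(1) pos(1)], rule act_X[OF s(1) pos(2)])
        have "\<exists>c. climbing c \<and> state c = state (s # t # a')"
          using t s climbing_lists by (intro climbing_exists) simp
        then obtain c where c: "climbing c" "state c = act s (act t (act s x))"
          using s by auto
        have tc: "climbing (t # s # c)" "state (t # s # c) = act s x"
          using s(1) t(1) c 2 pos pos2 by (simp_all add: desc_act act_act)
        have sc: "climbing (s # t # c)" "state (s # t # c) = act t x"
          using s(1) t(1) c(1) c(2)[unfolded eq] 2 pos pos2 by (simp_all add: desc_act act_act)
        have "a' \<sim> t # s # c \<and> length a' = length (t # s # c)"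
          using tc s ha by (intro IH) auto
        moreover have "b' \<sim> s # t # c \<and> length b' = length (s # t # c)"
          using sc t ha by (intro IH) auto
        moreover have "s # t # s # c \<sim> t # s # t # c"
          using s t c 2 by (intro braid_cong) (auto simp: climbing_lists)
        ultimately show ?thesis
          unfolding a b by (intro close[of "t # s # c" "s # t # c"]) simp_all
      qed
    qed
  qed
qed

text \<open>
  Every word reduces to a climbing word without becoming longer: a letter that fails to climb is the
  first letter of some climbing word for the state below it, and cancels against it.
\<close>

lemma climbing_cong_exists:
  assumes "w \<in> lists S"
  shows "\<exists>c. climbing c \<and> w \<sim> c \<and> length c \<le> length w"
  using assms
proof (induction w)
  case Nil
  then show ?case by (intro exI[of _ "[]"]) (simp add: coxeter_cong.refl)
next
  case (Cons s w)
  then obtain c where c: "climbing c" "w \<sim> c" "length c \<le> length w" and s: "s \<in> S" by auto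
  have sw: "s # w \<sim> s # c" using c s cong_Cons by simp
  have cS: "c \<in> lists S" using c climbing_lists by simp
  show ?case
  proof (cases "desc s (state c)")
    case False
    then show ?thesis using c s sw by (intro exI[of _ "s # c"]) simp
  next
    case True
    obtain d where d: "climbing d" "state d = state (s # c)"
      using climbing_exists[of "s # c"] s cS by auto
    have "climbing (s # d)" "state (s # d) = state c"
      using s d cS True by (simp_all add: desc_act act_act state_X)
    then have cd: "c \<sim> s # d" "length c = Suc (length d)"
      using climbing_unique[of c "s # d"] c by auto
    have "s # s # d \<sim> d"
      using cancel_cong[of s "[]" d] s d climbing_lists by simp
    then have "s # w \<sim> d"
      using sw cong_Cons[OF s cd(1)] coxeter_cong.trans by meson
    then show ?thesis using d cd c by (intro exI[of _ d]) simp
  qed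
qed

theorem cong_iff_state:
  assumes "u \<in> lists S" "v \<in> lists S"
  shows "u \<sim> v \<longleftrightarrow> state u = state v"
proof
  assume eq: "state u = state v"
  obtain c d where "climbing c" "u \<sim> c" "climbing d" "v \<sim> d"
    using climbing_cong_exists assms by meson
  moreover from this have "c \<sim> d"
    using climbing_unique[of c d] eq state_cong by metis
  ultimately show "u \<sim> v"
    by (meson coxeter_cong.sym coxeter_cong.trans)
qed (rule state_cong)

lemma length_climbing:
  assumes "climbing c" "u \<sim> c"
  shows "coxeter_length (word_class S m u) = length c"
  unfolding coxeter_length_def
proof (rule Least_equality)
  show "\<exists>v\<in>word_class S m u. length v = length c"
    using assms by (auto simp: word_class_def coxeter_rel_def)
next
  fix k assume "\<exists>v\<in>word_class S m u. length v = k"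
  then obtain v where v: "u \<sim> v" "length v = k"
    by (auto simp: word_class_def coxeter_rel_def)
  obtain d where d: "climbing d" "v \<sim> d" "length d \<le> length v"
    using climbing_cong_exists v coxeter_cong_lists by meson
  have "state c = state d"
    using assms v d state_cong by metis
  then show "length c \<le> k"
    using climbing_unique[of c d] assms d v by simp
qed

text \<open>
  If \<open>s\<close> is not a descent, it prolongs a climbing word for \<open>w\<close>. The other case is this one applied to
  \<open>s # w\<close>, because \<open>s # s # w\<close> cancels.
\<close>

theorem length_Cons_class:
  assumes "s \<in> S" "w \<in> lists S"
  shows "if desc s (state w)
    then coxeter_length (word_class S m w) = Suc (coxeter_length (word_class S m (s # w)))
    else coxeter_length (word_class S m (s # w)) = Suc (coxeter_length (word_class S m w))"
proof -
  have up: "coxeter_length (word_class S m (s # v)) = Suc (coxeter_length (word_class S m v))"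
    if v: "v \<in> lists S" "\<not> desc s (state v)" for v
  proof -
    obtain c where c: "climbing c" "v \<sim> c"
      using climbing_cong_exists v by meson
    then have "climbing (s # c)" "s # v \<sim> s # c"
      using assms v state_cong[of v c] cong_Cons by auto
    then show ?thesis
      using length_climbing[of c v] length_climbing[of "s # c" "s # v"] c by simp
  qed
  have "word_class S m (s # s # w) = word_class S m w"
    using assms cancel_cong[of s "[]" w] by (subst word_class_eq_iff) auto
  then show ?thesis
    using up[of w] up[of "s # w"] assms by (simp add: desc_act state_X)
qed

corollary left_descents_iff:
  assumes "s \<in> S" "w \<in> lists S"
  shows "s \<in> left_descents S m (word_class S m w) \<longleftrightarrow> desc s (state w)"
  using length_Cons_class[OF assms] assms
  by (auto simp: left_descents_def word_class_mult split: if_splits)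

end

section \<open>Affine permutations\<close>

definition swap_at :: "int \<Rightarrow> int \<Rightarrow> int \<Rightarrow> int" where
  "swap_at p i x = (if p dvd x - i then x + 1 else if p dvd x - i - 1 then x - 1 else x)"

text \<open>
  Injective periodic maps permute the residue classes, so these are bijections. The vanishing sum
  excludes the translations other than the identity.
\<close>

definition affine_perms :: "int \<Rightarrow> (int \<Rightarrow> int) set" where
  "affine_perms p = {u. (\<forall>x. u (x + p) = u x + p) \<and> inj u \<and> (\<Sum>x=1..p. u x - x) = 0}"

lemma shift_multiple:
  fixes f :: "int \<Rightarrow> int"
  assumes "\<And>x. f (x + p) = f x + p"
  shows "f (x + p * k) = f x + p * k"
proof (induction k rule: int_induct[of _ 0])
  case (step1 k)
  then show ?case using assms[of "x + p * k"] by (simp add: algebra_simps)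
next
  case (step2 k)
  then show ?case using assms[of "x + p * (k - 1)"] by (simp add: algebra_simps)
qed simp

lemma swap_at_shift: "swap_at p i (x + p) = swap_at p i x + p"
proof -
  have "x + p - i = (x - i) + p" "x + p - i - 1 = (x - i - 1) + p" by simp_all
  then show ?thesis unfolding swap_at_def by (simp only: dvd_add_triv_right_iff) simp
qed

lemmas swap_at_shift_multiple = shift_multiple[of "swap_at p i" p for p i, OF swap_at_shift]

lemma swap_at_cong:
  assumes "p dvd j - i"
  shows "swap_at p j = swap_at p i"
proof
  fix x
  have "p dvd x - j \<longleftrightarrow> p dvd x - i" "p dvd x - j - 1 \<longleftrightarrow> p dvd x - i - 1"
    using assms dvd_add_right_iff[of p "j - i" "x - j"] dvd_add_right_iff[of p "j - i" "x - j - 1"]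
    by (simp_all add: algebra_simps)
  then show "swap_at p j x = swap_at p i x" by (simp add: swap_at_def)
qed

lemma swap_at_same: "swap_at p i i = i + 1"
  by (simp add: swap_at_def)

lemma swap_at_next: "p \<ge> 2 \<Longrightarrow> swap_at p i (i + 1) = i"
  by (simp add: swap_at_def)

lemma swap_at_other: "\<not> p dvd x - i \<Longrightarrow> \<not> p dvd x - i - 1 \<Longrightarrow> swap_at p i x = x"
  by (simp add: swap_at_def)

lemma swap_at_within:
  assumes "i + 1 < x" "x < i + p"
  shows "swap_at p i x = x"
  using assms zdvd_not_zless[of "x - i" p] zdvd_not_zless[of "x - i - 1" p]
  by (intro swap_at_other) auto

lemma swap_at_cases [case_names first second other]:
  fixes x i p :: int
  assumes "\<And>k. x = i + p * k \<Longrightarrow> P" "\<And>k. x = i + 1 + p * k \<Longrightarrow> P"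
    "\<not> p dvd x - i \<Longrightarrow> \<not> p dvd x - i - 1 \<Longrightarrow> P"
  shows P
proof -
  have "x = i + p * k" if "x - i = p * k" for k using that by linarith
  moreover have "x = i + 1 + p * k" if "x - i - 1 = p * k" for k using that by linarith
  ultimately show P using assms unfolding dvd_def by metis
qed

lemma swap_at_involution:
  assumes "p \<ge> 2"
  shows "swap_at p i (swap_at p i x) = x"
proof (cases x i p rule: swap_at_cases)
  case (first k)
  then show ?thesis using assms by (simp add: swap_at_shift_multiple swap_at_same swap_at_next)
next
  case (second k)
  then show ?thesis using assms by (simp add: swap_at_shift_multiple swap_at_same swap_at_next)
next
  case other
  then show ?thesis by (simp add: swap_at_other)
qed

lemma swap_at_commute:
  assumes p: "p \<ge> 2" and far: "\<not> p dvd j - i" "\<not> p dvd j - i - 1" "\<not> p dvd j - i + 1"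
  shows "swap_at p i (swap_at p j x) = swap_at p j (swap_at p i x)"
proof -
  have neg: "\<not> p dvd i - j" "\<not> p dvd i - j - 1" "\<not> p dvd i - j + 1"
    using far dvd_minus_iff[of p "j - i"] dvd_minus_iff[of p "j - i - 1"]
      dvd_minus_iff[of p "j - i + 1"] by (simp_all add: algebra_simps)
  have same: "swap_at p i i = i + 1" "swap_at p j j = j + 1"
    by (simp_all add: swap_at_same)
  have fixed: "swap_at p i j = j" "swap_at p i (j + 1) = j + 1"
      "swap_at p j i = i" "swap_at p j (i + 1) = i + 1"
    using far neg by (auto simp: swap_at_def algebra_simps)
  show ?thesis
  proof (cases x i p rule: swap_at_cases)
    case (first k)
    then show ?thesis using fixed same by (simp add: swap_at_shift_multiple)
  next
    case (second k)
    then show ?thesis using p fixed same by (simp add: swap_at_shift_multiple swap_at_same swap_at_next)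
  next
    case other_i: other
    show ?thesis
    proof (cases x j p rule: swap_at_cases)
      case (first k)
      then show ?thesis using fixed same by (simp add: swap_at_shift_multiple)
    next
      case (second k)
      then show ?thesis using p fixed same by (simp add: swap_at_shift_multiple swap_at_same swap_at_next)
    next
      case other
      then show ?thesis using other_i by (simp add: swap_at_other)
    qed
  qed
qed

lemma swap_at_after: "p \<ge> 3 \<Longrightarrow> swap_at p i (i + 2) = i + 2"
  by (rule swap_at_within) simp_all

lemma swap_at_before: "p \<ge> 3 \<Longrightarrow> swap_at p (i + 1) i = i"
  using swap_at_within[of "i + 1" "i + p" p] swap_at_shift[of p "i + 1" i] by simp

lemma swap_at_second: "p \<ge> 2 \<Longrightarrow> swap_at p (i + 1) (i + 2) = i + 1"
  by (simp add: swap_at_def)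

lemma swap_at_first: "swap_at p (i + 1) (i + 1) = i + 2"
  by (simp add: swap_at_def)

lemmas swap_at_simps = swap_at_next swap_at_after swap_at_before swap_at_second swap_at_first

lemma swap_at_braid:
  assumes p: "p \<ge> 3"
  shows "swap_at p i (swap_at p (i + 1) (swap_at p i x)) =
    swap_at p (i + 1) (swap_at p i (swap_at p (i + 1) x))"
proof -
  \<comment> \<open>By periodicity it suffices to check the window of positions from \<open>i\<close> to \<open>i + p - 1\<close>.\<close>
  define y where "y = i + (x - i) mod p"
  define k where "k = (x - i) div p"
  have x: "x = y + p * k" by (simp add: y_def k_def)
  have y: "i \<le> y" "y < i + p" using p by (simp_all add: y_def)
  have "swap_at p i (swap_at p (i + 1) (swap_at p i y)) =
    swap_at p (i + 1) (swap_at p i (swap_at p (i + 1) y))"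
  proof -
    consider "y = i" | "y = i + 1" | "y = i + 2" | "i + 2 < y" using y by linarith
    then show ?thesis
    proof cases
      case 4
      then have "swap_at p i y = y" "swap_at p (i + 1) y = y"
        using y by (simp_all add: swap_at_within)
      then show ?thesis by simp
    qed (use p in \<open>simp_all add: swap_at_same[of p i] swap_at_simps\<close>)
  qed
  then show ?thesis unfolding x by (simp only: swap_at_shift_multiple)
qed

lemma sum_period_window:
  fixes f :: "int \<Rightarrow> int"
  assumes "p > 0" and per: "\<And>x. f (x + p) = f x"
  shows "sum f {a..<a + p} = sum f {b..<b + p}"
proof -
  have step: "sum f {a..<a + p} = sum f {a + 1..<a + 1 + p}" for a
  proof -
    have "{a..<a + p} = insert a {a + 1..<a + p}"
      "{a + 1..<a + 1 + p} = insert (a + p) {a + 1..<a + p}" using assms by auto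
    then show ?thesis using per by simp
  qed
  have up: "sum f {a..<a + p} = sum f {a + int k..<a + int k + p}" for a k
  proof (induction k)
    case (Suc k)
    then show ?case using step[of "a + int k"] by (simp add: algebra_simps)
  qed simp
  show ?thesis
  proof (cases "a \<le> b")
    case True
    then have "a + int (nat (b - a)) = b" by simp
    then show ?thesis using up[of a "nat (b - a)"] by (simp only:)
  next
    case False
    then have "b + int (nat (a - b)) = a" by simp
    then show ?thesis using up[of b "nat (a - b)"] by (simp only:)
  qed
qed

lemma affine_perms_shift: "u \<in> affine_perms p \<Longrightarrow> u (x + p) = u x + p"
  by (simp add: affine_perms_def)

lemma affine_perms_inj: "u \<in> affine_perms p \<Longrightarrow> u x = u y \<longleftrightarrow> x = y"
  by (auto simp: affine_perms_def dest: injD)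

text \<open>
  The displacement \<open>u x - x\<close> has period \<open>p\<close>, so the window over which it is summed does not matter. For
  \<open>g d = d\<close> this is the normalisation of affine permutations, for \<open>g d = d\<^sup>2\<close> it is the quantity that
  decreases along descents.
\<close>

definition displacement_sum :: "(int \<Rightarrow> int) \<Rightarrow> int \<Rightarrow> (int \<Rightarrow> int) \<Rightarrow> int" where
  "displacement_sum g p u = (\<Sum>x=1..p. g (u x - x))"

text \<open>
  Sum over the window that starts at \<open>i\<close>: there the swap affects only the first two positions, also when
  it wraps around the end of the window \<open>{1..p}\<close>.
\<close>

lemma displacement_sum_swap:
  assumes p: "p \<ge> 2" and u: "\<And>x. u (x + p) = u x + p"
  shows "displacement_sum g p (u \<circ> swap_at p i) = displacement_sum g p u
    - g (u i - i) - g (u (i + 1) - (i + 1)) + g (u (i + 1) - i) + g (u i - (i + 1))"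
proof -
  have window: "displacement_sum g p v = (\<Sum>x\<in>{i..<i + p}. g (v x - x))"
    if "\<And>x. v (x + p) = v x + p" for v
  proof -
    have "{1..p} = {1..<1 + p}" by auto
    then show ?thesis
      unfolding displacement_sum_def using p that
      by (simp only:) (rule sum_period_window, simp_all)
  qed
  have split: "{i..<i + p} = insert i (insert (i + 1) {i + 2..<i + p})"
    using p by auto
  have v: "(u \<circ> swap_at p i) (x + p) = (u \<circ> swap_at p i) x + p" for x
    by (simp add: swap_at_shift u)
  have "(\<Sum>x\<in>{i + 2..<i + p}. g ((u \<circ> swap_at p i) x - x)) =
    (\<Sum>x\<in>{i + 2..<i + p}. g (u x - x))"
    by (rule sum.cong) (auto simp: swap_at_within)
  then show ?thesis
    unfolding window[of u, OF u] window[of "u \<circ> swap_at p i", OF v] split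
    using p by (simp add: swap_at_same swap_at_next)
qed

lemma affine_perms_iff:
  "u \<in> affine_perms p \<longleftrightarrow>
    (\<forall>x. u (x + p) = u x + p) \<and> inj u \<and> displacement_sum (\<lambda>d. d) p u = 0"
  by (simp add: affine_perms_def displacement_sum_def)

lemma swap_affine_perms:
  assumes "p \<ge> 2" "u \<in> affine_perms p"
  shows "u \<circ> swap_at p i \<in> affine_perms p"
proof -
  have "inj (swap_at p i)"
    using swap_at_involution[OF assms(1)] by (metis injI)
  then show ?thesis
    using assms displacement_sum_swap[OF assms(1), of u "\<lambda>d. d" i]
    by (auto simp: affine_perms_iff swap_at_shift inj_compose)
qed

text \<open>
  A replacement for the number of inversions: much easier to compute with, and as good for induction.
\<close>

definition height :: "int \<Rightarrow> (int \<Rightarrow> int) \<Rightarrow> nat" where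
  "height p u = nat (displacement_sum (\<lambda>d. d ^ 2) p u)"

definition drop_at :: "int \<Rightarrow> (int \<Rightarrow> int) \<Rightarrow> bool" where
  "drop_at i u \<longleftrightarrow> u i > u (i + 1)"

lemma drop_at_next: "drop_at (i + 1) u \<longleftrightarrow> u (i + 1) > u (i + 2)"
  unfolding drop_at_def add.assoc by simp

text \<open>
  Swapping the values \<open>a > b\<close> at two neighbouring positions lowers the sum of squared displacements by
  \<open>2 (a - b)\<close>.
\<close>

lemma height_swap:
  assumes "p \<ge> 2" "u \<in> affine_perms p" "drop_at i u"
  shows "height p (u \<circ> swap_at p i) < height p u"
proof -
  have "displacement_sum (\<lambda>d. d ^ 2) p (u \<circ> swap_at p i) =
      displacement_sum (\<lambda>d. d ^ 2) p u - 2 * (u i - u (i + 1))"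
    using displacement_sum_swap[OF assms(1), of u "\<lambda>d. d ^ 2" i] assms(2)
    by (simp add: affine_perms_shift power2_eq_square algebra_simps)
  moreover have "displacement_sum (\<lambda>d. d ^ 2) p (u \<circ> swap_at p i) \<ge> 0"
    unfolding displacement_sum_def by (intro sum_nonneg) simp
  ultimately show ?thesis
    using assms(3) by (simp add: height_def drop_at_def)
qed

text \<open>
  The displacements over a window have sum zero, so they vanish if they all have the same sign.
\<close>

lemma affine_perm_eq_id:
  assumes p: "p > 0" and u: "u \<in> affine_perms p"
    and "(\<forall>x\<in>{1..p}. u x \<ge> x) \<or> (\<forall>x\<in>{1..p}. u x \<le> x)"
  shows "u = id"
proof
  fix y
  have sums: "(\<Sum>x=1..p. u x - x) = 0" "(\<Sum>x=1..p. x - u x) = 0"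
    using u by (simp_all add: affine_perms_def sum_subtractf)
  have same: "swap_at p i i = i + 1" "swap_at p j j = j + 1"
    by (simp_all add: swap_at_same)
  have fixed: "u x = x" if "x \<in> {1..p}" for x
    using assms(3)
  proof
    assume "\<forall>x\<in>{1..p}. u x \<ge> x"
    then have "\<forall>x\<in>{1..p}. u x - x = 0"
      using sums(1) by (subst (asm) sum_nonneg_eq_0_iff) auto
    then show ?thesis using that by simp
  next
    assume "\<forall>x\<in>{1..p}. u x \<le> x"
    then have "\<forall>x\<in>{1..p}. x - u x = 0"
      using sums(2) by (subst (asm) sum_nonneg_eq_0_iff) auto
    then show ?thesis using that by simp
  qed
  define x where "x = 1 + (y - 1) mod p"
  have y: "y = x + p * ((y - 1) div p)" by (simp add: x_def)
  have "0 \<le> (y - 1) mod p" "(y - 1) mod p < p" using p by simp_all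
  then have "x \<in> {1..p}" unfolding x_def by auto
  then have "u (x + p * ((y - 1) div p)) = x + p * ((y - 1) div p)"
    using fixed affine_perms_shift[OF u] by (simp add: shift_multiple)
  then show "u y = id y" using y by simp
qed

text \<open>
  If \<open>u 1 \<ge> 1\<close>, then \<open>u x \<ge> x\<close> on the whole window because \<open>u\<close> increases there; likewise
  \<open>u p \<le> p\<close> gives \<open>u x \<le> x\<close>. In both cases \<open>u\<close> is the identity. The two bounds are what later makes
  the affine generator a descent that costs three letters after the embedding.
\<close>

lemma increasing_affine_perm:
  assumes p: "p > 0" and u: "u \<in> affine_perms p" "u \<noteq> id"
    and inc: "\<And>x. 1 \<le> x \<Longrightarrow> x < p \<Longrightarrow> \<not> drop_at x u"
  shows "u 1 \<le> 0" "u p \<ge> p + 1"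
proof -
  have step: "u x + 1 \<le> u (x + 1)" if "1 \<le> x" "x < p" for x
    using inc[OF that] affine_perms_inj[OF u(1), of x "x + 1"] by (simp add: drop_at_def)
  have up: "u 1 + int k \<le> u (1 + int k)" if "1 + int k \<le> p" for k
    using that
  proof (induction k)
    case (Suc k)
    then show ?case using step[of "1 + int k"] by (simp add: algebra_simps)
  qed simp
  have down: "u (p - int k) \<le> u p - int k" if "1 + int k \<le> p" for k
    using that
  proof (induction k)
    case (Suc k)
    then show ?case using step[of "p - int k - 1"] by (simp add: algebra_simps)
  qed simp
  show "u 1 \<le> 0"
  proof (rule ccontr)
    assume "\<not> u 1 \<le> 0"
    then have "\<forall>x\<in>{1..p}. u x \<ge> x"
      using up[of "nat (x - 1)" for x] by (smt (verit) atLeastAtMost_iff int_nat_eq)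
    then show False using affine_perm_eq_id[OF p u(1)] u(2) by blast
  qed
  show "u p \<ge> p + 1"
  proof (rule ccontr)
    assume "\<not> u p \<ge> p + 1"
    then have "\<forall>x\<in>{1..p}. u x \<le> x"
      using down[of "nat (p - x)" for x] by (smt (verit) atLeastAtMost_iff int_nat_eq)
    then show False using affine_perm_eq_id[OF p u(1)] u(2) by blast
  qed
qed

lemma drop_at_swap:
  assumes "p \<ge> 2" "u \<in> affine_perms p"
  shows "drop_at i (u \<circ> swap_at p i) \<longleftrightarrow> \<not> drop_at i u"
  using assms affine_perms_inj[OF assms(2), of i "i + 1"]
  by (auto simp: drop_at_def swap_at_same swap_at_next)

lemma drop_at_cong:
  assumes "u \<in> affine_perms p" "p dvd j - i"
  shows "drop_at j u \<longleftrightarrow> drop_at i u"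
proof -
  obtain k where k: "j = i + p * k"
    using assms(2) by (metis add_diff_cancel_left' diff_add_cancel add.commute dvdE)
  have "u (x + p * k) = u x + p * k" for x
    using affine_perms_shift[OF assms(1)] by (rule shift_multiple)
  from this[of i] this[of "i + 1"] show ?thesis unfolding k drop_at_def by (simp add: algebra_simps)
qed

section \<open>Affine type A acts faithfully on affine permutations\<close>

text \<open>
  The generator of index \<open>i\<close> swaps the values at positions congruent to \<open>i\<close> and \<open>i + 1\<close>. In rank \<open>n\<close> the
  period is \<open>n + 1\<close>, so the affine generator \<open>Aff (n + 1)\<close> sits at the end of the window \<open>{1..n + 1}\<close>.
\<close>

fun affA_index :: "affA_gen \<Rightarrow> int" where
  "affA_index (Sig i) = int i"
| "affA_index (Aff k) = int k"

lemma affA_index_image: "affA_index ` affA_gens n = {1..int n + 1}"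
proof -
  have "affA_index ` affA_gens n = int ` {1..n} \<union> {int n + 1}"
    by (auto simp: affA_gens_def image_image)
  also have "\<dots> = {1..int n + 1}"
    by (auto simp: image_int_atLeastAtMost)
  finally show ?thesis .
qed

lemma affA_matrix_sym: "affA_matrix n s t = affA_matrix n t s"
  by (cases s; cases t) (auto simp: affA_matrix_def)

lemma dvd_small_int:
  fixes d p :: int
  assumes "p dvd d" "\<bar>d\<bar> < p"
  shows "d = 0"
  using assms dvd_imp_le_int[of d p] by linarith

text \<open>
  The Coxeter matrix in terms of the indices. Neighbours in the diagram have indices that differ by one
  modulo the period, and in rank one both neighbour relations hold at the same time.
\<close>

lemma affA_pair_cases [consumes 3, case_names far near infinite]:
  assumes s: "s \<in> affA_gens n" and t: "t \<in> affA_gens n" and "s \<noteq> t"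
  defines "p \<equiv> int n + 1" and "d \<equiv> affA_index t - affA_index s"
  assumes far: "affA_matrix n s t = 2 \<Longrightarrow> \<not> p dvd d \<Longrightarrow> \<not> p dvd d - 1 \<Longrightarrow> \<not> p dvd d + 1 \<Longrightarrow> P"
    and near: "affA_matrix n s t = 3 \<Longrightarrow> p \<ge> 3 \<Longrightarrow> p dvd d - 1 \<or> p dvd d + 1 \<Longrightarrow> P"
    and infinite: "affA_matrix n s t = 0 \<Longrightarrow> n = 1 \<Longrightarrow> p dvd d - 1 \<Longrightarrow> P"
  shows P
proof -
  have bounds: "1 \<le> affA_index s" "affA_index s \<le> p" "1 \<le> affA_index t" "affA_index t \<le> p"
    using s t affA_index_image[of n] unfolding p_def by auto
  have ne: "d \<noteq> 0"
    using s t \<open>s \<noteq> t\<close> by (auto simp: affA_gens_def d_def)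
  have d: "\<bar>d\<bar> < p" using bounds by (simp add: d_def)
  have adj: "affA_adjacent n s t \<longleftrightarrow> \<bar>d\<bar> = 1 \<or> \<bar>d\<bar> = int n"
    using s t \<open>s \<noteq> t\<close> by (auto simp: affA_gens_def d_def)
  show P
  proof (cases "affA_adjacent n s t")
    case False
    have "\<not> p dvd d" "\<not> p dvd d - 1" "\<not> p dvd d + 1"
      using False ne d dvd_imp_le_int[of d p] dvd_imp_le_int[of "d - 1" p]
        dvd_imp_le_int[of "d + 1" p]
      unfolding adj p_def by (auto simp: abs_if split: if_splits)
    then show P using far False \<open>s \<noteq> t\<close> by (simp add: affA_matrix_def)
  next
    case True
    then have "d = 1 \<or> d = -1 \<or> d = p - 1 \<or> d = 1 - p"
      unfolding adj p_def by auto
    then have dvd: "p dvd d - 1 \<or> p dvd d + 1" by auto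
    have "n \<ge> 1" using ne d by (cases n) (auto simp: p_def)
    show P
    proof (cases "n = 1")
      case True
      then have "d = 1 \<or> d = -1" using ne d by (auto simp: p_def)
      then have "p dvd d - 1" using True by (auto simp: p_def)
      then show P using infinite True \<open>affA_adjacent n s t\<close> \<open>s \<noteq> t\<close> by (simp add: affA_matrix_def)
    next
      case False
      then show P using near dvd True \<open>s \<noteq> t\<close> \<open>n \<ge> 1\<close> by (simp add: affA_matrix_def p_def)
    qed
  qed
qed

text \<open>
  The action is on positions, from the right: the state of \<open>s # w\<close> is the state of \<open>w\<close> composed with the
  swap of \<open>s\<close>. A word thus acts as the inverse of the group element that it represents, and left
  descents become visible as decreasing neighbours.
\<close>

definition swap_action :: "int \<Rightarrow> affA_gen \<Rightarrow> (int \<Rightarrow> int) \<Rightarrow> (int \<Rightarrow> int)" where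
  "swap_action p s u = u \<circ> swap_at p (affA_index s)"

definition falls :: "affA_gen \<Rightarrow> (int \<Rightarrow> int) \<Rightarrow> bool" where
  "falls s u \<longleftrightarrow> drop_at (affA_index s) u"

text \<open>
  The state of \<open>w\<close> under this action, as a constant that does not carry the action as a parameter.
\<close>

primrec affA_perm :: "nat \<Rightarrow> affA_gen list \<Rightarrow> int \<Rightarrow> int" where
  "affA_perm n [] = id"
| "affA_perm n (s # w) = affA_perm n w \<circ> swap_at (int n + 1) (affA_index s)"

locale affine_type_A =
  fixes n :: nat
  assumes rank_pos: "n \<ge> 1"
begin

abbreviation period :: int where
  "period \<equiv> int n + 1"

abbreviation swap_gen :: "affA_gen \<Rightarrow> int \<Rightarrow> int" where
  "swap_gen s \<equiv> swap_at period (affA_index s)"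

lemma period_ge_2: "period \<ge> 2"
  using rank_pos by simp

lemma swap_gen_involution: "swap_gen s \<circ> swap_gen s = id"
  using swap_at_involution[OF period_ge_2] by auto

lemma relator_acts_trivially:
  assumes "s \<in> affA_gens n" "t \<in> affA_gens n"
  shows "foldr (swap_action period) (concat (replicate (affA_matrix n s t) [s, t])) u = u"
proof (cases "s = t")
  case True
  then show ?thesis
    using swap_gen_involution[of t] by (simp add: affA_matrix_def swap_action_def comp_assoc)
next
  case False
  have inv: "swap_gen r (swap_gen r x) = x" for r x
    using swap_at_involution[OF period_ge_2] .
  from assms False show ?thesis
  proof (cases rule: affA_pair_cases)
    case far
    then have "swap_gen s (swap_gen t x) = swap_gen t (swap_gen s x)" for x
      by (intro swap_at_commute[OF period_ge_2])
    then show ?thesis using far(1) inv by (simp add: numeral_2_eq_2 swap_action_def fun_eq_iff)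
  next
    case near
    have "swap_gen s (swap_gen t (swap_gen s x)) = swap_gen t (swap_gen s (swap_gen t x))" for x
      using near(3)
    proof
      assume "period dvd affA_index t - affA_index s - 1"
      then have "swap_gen t = swap_at period (affA_index s + 1)"
        by (intro swap_at_cong) (simp add: algebra_simps)
      then show ?thesis using swap_at_braid[OF near(2)] by simp
    next
      assume "period dvd affA_index t - affA_index s + 1"
      then have "swap_gen s = swap_at period (affA_index t + 1)"
        using dvd_minus_iff[of period "affA_index t - affA_index s + 1"]
        by (intro swap_at_cong) (simp add: algebra_simps)
      then show ?thesis using swap_at_braid[OF near(2)] by simp
    qed
    then show ?thesis using near(1) inv by (simp add: numeral_3_eq_3 swap_action_def fun_eq_iff)
  qed (simp)
qed

text \<open>
  For \<open>u i > u (i + 1) > u (i + 2)\<close> the three values can be sorted by swaps starting at either end. In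
  rank one the situation does not arise, since it would force \<open>u i > u (i + 2) = u i + 2\<close>.
\<close>

lemma drop_pair:
  assumes "s \<in> affA_gens n" "t \<in> affA_gens n" "s \<noteq> t" and u: "u \<in> affine_perms period"
    and drop: "drop_at (affA_index s) u" "drop_at (affA_index t) u"
  shows "affA_matrix n s t = 2 \<and> drop_at (affA_index t) (u \<circ> swap_gen s) \<or>
    affA_matrix n s t = 3 \<and> drop_at (affA_index t) (u \<circ> swap_gen s) \<and>
      drop_at (affA_index s) (u \<circ> swap_gen s \<circ> swap_gen t)"
  using assms(1-3)
proof (cases rule: affA_pair_cases)
  case far
  then have "swap_gen s (affA_index t) = affA_index t"
    "swap_gen s (affA_index t + 1) = affA_index t + 1"
    by (auto simp: swap_at_def algebra_simps)
  then show ?thesis using far(1) drop(2) by (simp add: drop_at_def)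
next
  case near
  from near(3) show ?thesis
  proof
    define i where "i = affA_index s"
    assume "period dvd affA_index t - affA_index s - 1"
    then have t: "period dvd affA_index t - (i + 1)" by (simp add: i_def algebra_simps)
    note sw = swap_at_cong[OF t] and dr = drop_at_cong[OF _ t]
    have "u \<circ> swap_at period i \<in> affine_perms period"
      using u period_ge_2 by (rule swap_affine_perms[rotated])
    then show ?thesis
      using near(1,2) drop u unfolding i_def[symmetric] sw
      by (simp add: dr[of u] dr[of "u \<circ> swap_at period i"])
        (simp add: drop_at_next drop_at_def[of i] swap_at_simps swap_at_same[of _ i])
  next
    define i where "i = affA_index t"
    assume "period dvd affA_index t - affA_index s + 1"
    then have s: "period dvd affA_index s - (i + 1)"
      using dvd_minus_iff[of period "affA_index t - affA_index s + 1"]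
      by (simp add: i_def algebra_simps)
    note sw = swap_at_cong[OF s] and dr = drop_at_cong[OF _ s]
    have "u \<circ> swap_at period (i + 1) \<circ> swap_at period i \<in> affine_perms period"
      using u period_ge_2 by (intro swap_affine_perms)
    then show ?thesis
      using near(1,2) drop u unfolding i_def[symmetric] sw
      by (simp add: dr[of u] dr[of "u \<circ> swap_at period (i + 1) \<circ> swap_at period i"])
        (simp add: drop_at_next drop_at_def[of i] swap_at_simps swap_at_same[of _ i])
  qed
next
  case infinite
  then have "drop_at (affA_index s + 1) u"
    using drop(2) drop_at_cong[OF u, of "affA_index t" "affA_index s + 1"]
    by (simp add: algebra_simps)
  then show ?thesis
    using drop(1) affine_perms_shift[OF u, of "affA_index s"] infinite(2)
    by (simp add: drop_at_def algebra_simps)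
qed

text \<open>
  A permutation that increases along the window and is not the identity has \<open>u 1 \<le> 0\<close> and
  \<open>u p \<ge> p + 1\<close>, hence \<open>u p > u 1 + p = u (p + 1)\<close>: it drops at the end of the window.
\<close>

lemma no_drop_imp_id:
  assumes u: "u \<in> affine_perms period" and "\<And>s. s \<in> affA_gens n \<Longrightarrow> \<not> drop_at (affA_index s) u"
  shows "u = id"
proof (rule ccontr)
  assume "u \<noteq> id"
  have nodrop: "\<not> drop_at x u" if "1 \<le> x" "x \<le> period" for x
    using assms(2) affA_index_image[of n] that by (metis atLeastAtMost_iff imageE)
  have "u 1 \<le> 0" "u period \<ge> period + 1"
    using increasing_affine_perm[OF _ u \<open>u \<noteq> id\<close>] nodrop by auto
  moreover have "u (period + 1) = u 1 + period"
    using affine_perms_shift[OF u, of 1] by (simp add: add.commute)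
  moreover have "\<not> drop_at period u" using nodrop[of period] by simp
  ultimately show False by (simp add: drop_at_def)
qed

sublocale coxeter_descent_action "affA_gens n" "affA_matrix n" "affine_perms period"
  "swap_action period" id falls "height period"
proof
  show "id \<in> affine_perms period" by (simp add: affine_perms_def)
  show "\<not> falls s id" for s by (simp add: falls_def drop_at_def)
  show "foldr (swap_action period) (concat (replicate (affA_matrix n s t) [s, t])) u = u"
    if "s \<in> affA_gens n" "t \<in> affA_gens n" for s t u
    using relator_acts_trivially that .
  show "affA_matrix n s t = 2 \<and> falls t (swap_action period s u) \<or>
      affA_matrix n s t = 3 \<and> falls t (swap_action period s u) \<and>
        falls s (swap_action period t (swap_action period s u))"
    if "s \<in> affA_gens n" "t \<in> affA_gens n" "u \<in> affine_perms period" "s \<noteq> t" "falls s u" "falls t u"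
    for s t u
    using drop_pair[of s t u] that by (simp add: falls_def swap_action_def)
  show "u = id" if "u \<in> affine_perms period" "\<And>s. s \<in> affA_gens n \<Longrightarrow> \<not> falls s u" for u
    using no_drop_imp_id that by (simp add: falls_def)
qed (use period_ge_2 in \<open>auto simp: falls_def swap_action_def affA_matrix_sym swap_affine_perms
    drop_at_swap height_swap affA_matrix_def[of _ s s for s]\<close>)

lemma state_eq_affA_perm: "state w = affA_perm n w"
proof (induction w)
  case Nil
  show ?case unfolding state_simps affA_perm.simps ..
next
  case (Cons s w)
  show ?case unfolding state_simps Cons.IH by (simp add: swap_action_def)
qed

lemma affA_perm_affine: "w \<in> lists (affA_gens n) \<Longrightarrow> affA_perm n w \<in> affine_perms period"
  using state_X[of w] unfolding state_eq_affA_perm .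

lemma word_class_eq_iff_affA_perm:
  assumes "v \<in> lists (affA_gens n)" "w \<in> lists (affA_gens n)"
  shows "word_class (affA_gens n) (affA_matrix n) v = word_class (affA_gens n) (affA_matrix n) w \<longleftrightarrow>
    affA_perm n v = affA_perm n w"
  unfolding word_class_eq_iff[OF assms] cong_iff_state[OF assms] state_eq_affA_perm ..

lemma falls_Nil: "\<not> falls s (affA_perm n [])"
  by (simp add: falls_def drop_at_def)

lemma falls_Cons:
  "s \<in> affA_gens n \<Longrightarrow> w \<in> lists (affA_gens n) \<Longrightarrow>
    falls s (affA_perm n (s # w)) \<longleftrightarrow> \<not> falls s (affA_perm n w)"
  using desc_act[OF _ affA_perm_affine, of s w] by (simp add: swap_action_def)

lemmas left_descents_iff_falls = left_descents_iff[unfolded state_eq_affA_perm]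
lemmas length_Cons_class_falls = length_Cons_class[unfolded state_eq_affA_perm]

lemma height_affA_perm_Cons:
  "s \<in> affA_gens n \<Longrightarrow> w \<in> lists (affA_gens n) \<Longrightarrow> falls s (affA_perm n w) \<Longrightarrow>
    height period (affA_perm n (s # w)) < height period (affA_perm n w)"
  using height_desc[OF _ affA_perm_affine, of s w] by (simp add: swap_action_def)

end

section \<open>Leading terms in Hecke algebras\<close>

lemma lookup_scale: "Poly_Mapping.lookup (scale c x) w = c * Poly_Mapping.lookup x w"
  by (simp add: scale_def Poly_Mapping.map.rep_eq when_def)

lemma lookup_hbasis: "Poly_Mapping.lookup (hbasis v) w = (if v = w then 1 else 0)"
  by (simp add: hbasis_def lookup_single when_def)

lemma scale_add_right: "scale c (x + y) = scale c x + scale c y"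
  by (rule poly_mapping_eqI) (simp add: lookup_scale lookup_add algebra_simps)

lemma scale_add_left: "scale (c + d) x = scale c x + scale d x"
  by (rule poly_mapping_eqI) (simp add: lookup_scale lookup_add algebra_simps)

lemma scale_scale: "scale c (scale d x) = scale (c * d) x"
  by (rule poly_mapping_eqI) (simp add: lookup_scale algebra_simps)

lemma scale_0 [simp]: "scale 0 x = 0"
  by (rule poly_mapping_eqI) (simp add: lookup_scale)

lemma scale_1 [simp]: "scale 1 x = x"
  by (rule poly_mapping_eqI) (simp add: lookup_scale)

lemma keys_scale: "Poly_Mapping.keys (scale c x) \<subseteq> Poly_Mapping.keys x"
  by (auto simp: in_keys_iff lookup_scale)

lemma keys_hbasis: "Poly_Mapping.keys (hbasis w) \<subseteq> {w}"
  by (auto simp: in_keys_iff lookup_hbasis split: if_splits)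

lemma hbasis_expansion:
  "x = (\<Sum>w\<in>Poly_Mapping.keys x. scale (Poly_Mapping.lookup x w) (hbasis w))"
proof (rule poly_mapping_eqI)
  fix v
  let ?c = "Poly_Mapping.lookup x"
  have "Poly_Mapping.lookup (\<Sum>w\<in>Poly_Mapping.keys x. scale (?c w) (hbasis w)) v =
      (\<Sum>w\<in>Poly_Mapping.keys x. if w = v then ?c w else 0)"
    unfolding lookup_sum lookup_scale lookup_hbasis by (rule sum.cong) simp_all
  also have "\<dots> = ?c v"
    by (subst sum.delta) (auto simp: in_keys_iff)
  finally show "?c v = Poly_Mapping.lookup (\<Sum>w\<in>Poly_Mapping.keys x. scale (?c w) (hbasis w)) v" ..
qed

context hecke_algebra
begin

lemma hbasis_closed: "w \<in> carrier (coxeter_group S m) \<Longrightarrow> hbasis w \<in> carrier H"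
  using keys_hbasis[of w] by (auto simp: carrier_eq)

lemma scale_closed: "x \<in> carrier H \<Longrightarrow> scale c x \<in> carrier H"
  using keys_scale[of c x] by (auto simp: carrier_eq)

lemma plus_closed: "x \<in> carrier H \<Longrightarrow> y \<in> carrier H \<Longrightarrow> x + y \<in> carrier H"
  using Poly_Mapping.keys_add[of x y] by (auto simp: carrier_eq)

lemma mult_plus_right:
  "x \<in> carrier H \<Longrightarrow> y \<in> carrier H \<Longrightarrow> z \<in> carrier H \<Longrightarrow> x \<otimes> (y + z) = x \<otimes> y + x \<otimes> z"
  using r_distr[of y z x] by (simp add: add_eq)

lemma mult_plus_left:
  "x \<in> carrier H \<Longrightarrow> y \<in> carrier H \<Longrightarrow> z \<in> carrier H \<Longrightarrow> (x + y) \<otimes> z = x \<otimes> z + y \<otimes> z"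
  using l_distr[of x y z] by (simp add: add_eq)

text \<open>
  Reduces statements about linear maps to basis elements; \<open>f\<close> will be the multiplication by a fixed
  element or the map between two Hecke algebras.
\<close>

lemma linear_expansion:
  fixes f :: "('s list set \<Rightarrow>\<^sub>0 'k) \<Rightarrow> ('w \<Rightarrow>\<^sub>0 'k)"
  assumes add: "\<And>x y. x \<in> carrier H \<Longrightarrow> y \<in> carrier H \<Longrightarrow> f (x + y) = f x + f y"
    and scl: "\<And>c x. x \<in> carrier H \<Longrightarrow> f (scale c x) = scale c (f x)"
    and x: "x \<in> carrier H"
  shows "f x = (\<Sum>w\<in>Poly_Mapping.keys x. scale (Poly_Mapping.lookup x w) (f (hbasis w)))"
proof -
  have f0: "f 0 = 0"
    using scl[of 0 0] zero_closed by (simp add: zero_eq)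
  have "f (\<Sum>w\<in>A. scale (c w) (hbasis w)) = (\<Sum>w\<in>A. scale (c w) (f (hbasis w))) \<and>
      (\<Sum>w\<in>A. scale (c w) (hbasis w)) \<in> carrier H"
    if "finite A" "A \<subseteq> carrier (coxeter_group S m)" for A and c :: "'s list set \<Rightarrow> 'k"
    using that
  proof (induction A)
    case empty
    then show ?case using f0 zero_closed by (simp add: zero_eq)
  next
    case (insert w A)
    then show ?case
      using add scl by (simp add: hbasis_closed scale_closed plus_closed)
  qed
  then have "f (\<Sum>w\<in>Poly_Mapping.keys x. scale (Poly_Mapping.lookup x w) (hbasis w)) =
      (\<Sum>w\<in>Poly_Mapping.keys x. scale (Poly_Mapping.lookup x w) (f (hbasis w)))"
    using x by (simp add: carrier_eq)
  then show ?thesis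
    unfolding hbasis_expansion[symmetric] .
qed

text \<open>
  The filtration by length, against which leading terms are taken.
\<close>

definition shorter_span :: "nat \<Rightarrow> ('s list set \<Rightarrow>\<^sub>0 'k) set" where
  "shorter_span k = {x \<in> carrier H. \<forall>w\<in>Poly_Mapping.keys x. coxeter_length w < k}"

lemma shorter_span_closed: "x \<in> shorter_span k \<Longrightarrow> x \<in> carrier H"
  by (simp add: shorter_span_def)

lemma shorter_span_mono: "x \<in> shorter_span k \<Longrightarrow> k \<le> k' \<Longrightarrow> x \<in> shorter_span k'"
  by (auto simp: shorter_span_def)

lemma shorter_span_plus:
  "x \<in> shorter_span k \<Longrightarrow> y \<in> shorter_span k \<Longrightarrow> x + y \<in> shorter_span k"
  using Poly_Mapping.keys_add[of x y] by (auto simp: shorter_span_def plus_closed)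

lemma shorter_span_scale: "x \<in> shorter_span k \<Longrightarrow> scale c x \<in> shorter_span k"
  using keys_scale[of c x] by (auto simp: shorter_span_def scale_closed)

lemma shorter_span_hbasis:
  "w \<in> carrier (coxeter_group S m) \<Longrightarrow> coxeter_length w < k \<Longrightarrow> hbasis w \<in> shorter_span k"
  using keys_hbasis[of w] hbasis_closed[of w] by (auto simp: shorter_span_def)

lemma shorter_span_sum:
  assumes "\<And>w. w \<in> A \<Longrightarrow> f w \<in> shorter_span k"
  shows "sum f A \<in> shorter_span k"
proof -
  have "0 \<in> shorter_span k" using zero_closed by (simp add: shorter_span_def zero_eq)
  then show ?thesis
    using assms by (induction A rule: infinite_finite_induct) (auto intro: shorter_span_plus)
qed

end

locale affA_hecke = affA_hecke_algebra n q H + affine_type_A n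
  for n :: nat and q :: "'k::comm_ring_1" and H :: "(affA_gen list set \<Rightarrow>\<^sub>0 'k) ring" (structure) +
  fixes q' :: 'k
  assumes q_inverse: "q * q' = 1"
begin

abbreviation gens :: "affA_gen set" where
  "gens \<equiv> affA_gens n"

abbreviation cls :: "affA_gen list \<Rightarrow> affA_gen list set" where
  "cls \<equiv> word_class (affA_gens n) (affA_matrix n)"

abbreviation len :: "affA_gen list \<Rightarrow> nat" where
  "len w \<equiv> coxeter_length (cls w)"

lemma cls_closed: "w \<in> lists gens \<Longrightarrow> cls w \<in> carrier (coxeter_group (affA_gens n) (affA_matrix n))"
  by (auto simp: carrier_coxeter_group)

lemma basis_closed: "w \<in> lists gens \<Longrightarrow> hbasis (cls w) \<in> carrier H"
  by (intro hbasis_closed cls_closed)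

lemma T_closed: "s \<in> gens \<Longrightarrow> affA_T n s \<in> carrier H"
  unfolding affA_T_def by (intro basis_closed) simp

lemma T_mult_basis:
  assumes "s \<in> gens" "w \<in> lists gens"
  shows "affA_T n s \<otimes> hbasis (cls w) =
    (if falls s (affA_perm n w) then scale q (hbasis (cls (s # w))) + scale (q - 1) (hbasis (cls w))
     else hbasis (cls (s # w)))"
  using mult_ascent[of s "cls w"] mult_descent[of s "cls w"] assms cls_closed[of w]
  by (simp add: affA_T_def left_descents_iff_falls word_class_mult)

lemma cls_cancel: "s \<in> gens \<Longrightarrow> w \<in> lists gens \<Longrightarrow> cls (s # s # w) = cls w"
  using cancel_cong[of s "[]" w] by (subst word_class_eq_iff) auto

lemma basis_eq_T_mult:
  assumes "s \<in> gens" "w \<in> lists gens" "falls s (affA_perm n w)"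
  shows "hbasis (cls w) = affA_T n s \<otimes> hbasis (cls (s # w))"
  using T_mult_basis[of s "s # w"] assms falls_Cons[of s w] cls_cancel[of s w]
  by simp

lemma T_square:
  assumes "s \<in> gens"
  shows "affA_T n s \<otimes> affA_T n s = scale q (hbasis (cls [])) + scale (q - 1) (affA_T n s)"
proof -
  have "falls s (affA_perm n [s])" using assms falls_Cons[of s "[]"] falls_Nil by simp
  then show ?thesis
    using T_mult_basis[of s "[s]"] cls_cancel[of s "[]"] assms by (simp add: affA_T_def)
qed

text \<open>
  The multiplication rules only describe left multiplication by generators, and the unit is not part
  of them. They show, by induction along climbing words, that \<open>g_1\<close> is a right unit, which then
  coincides with \<open>\<one>\<close>. The word \<open>[]\<close> itself is obtained from \<open>g_s g_s = q g_1 + (q - 1) g_s\<close>; this uses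
  that \<open>q\<close> is invertible.
\<close>

lemma one_eq_basis: "hbasis (cls []) = \<one>"
proof -
  let ?e = "hbasis (cls [])"
  have e: "?e \<in> carrier H" by (intro basis_closed) simp
  have climb: "hbasis (cls w) \<otimes> ?e = hbasis (cls w)" if "climbing w" for w
    using that
  proof (induction w)
    case Nil
    define s where "s = Aff (n + 1)"
    have s: "s \<in> gens" by (simp add: affA_gens_def s_def)
    let ?T = "affA_T n s"
    have T: "?T \<in> carrier H" "?T \<otimes> ?e = ?T"
      using s T_closed T_mult_basis[of s "[]"] by (simp_all only: falls_Nil affA_T_def lists.intros if_False)
    have sq: "?T \<otimes> ?T = scale q ?e + scale (q - 1) ?T"
      using T_square[OF s] .
    have "(scale q ?e + scale (q - 1) ?T) \<otimes> ?e = scale q ?e + scale (q - 1) ?T"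
      unfolding sq[symmetric] using m_assoc[OF T(1) T(1) e] T by simp
    then have "scale q (?e \<otimes> ?e) = scale q ?e"
      using T e by (simp add: mult_plus_left scale_left scale_closed)
    then have "scale q' (scale q (?e \<otimes> ?e)) = scale q' (scale q ?e)" by simp
    then show ?case using q_inverse by (simp add: scale_scale mult.commute)
  next
    case (Cons s w)
    then have w: "s \<in> gens" "w \<in> lists gens" "\<not> falls s (affA_perm n w)" "hbasis (cls w) \<otimes> ?e = hbasis (cls w)"
      unfolding climbing.simps(2) state_eq_affA_perm using climbing_lists by blast+
    then have "hbasis (cls (s # w)) = affA_T n s \<otimes> hbasis (cls w)"
      using T_mult_basis by simp
    then show ?case
      using w e T_closed basis_closed by (simp add: m_assoc)
  qed
  have right_unit: "x \<otimes> ?e = x" if "x \<in> carrier H" for x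
  proof -
    have basis: "hbasis w \<otimes> ?e = hbasis w" if w: "w \<in> carrier (coxeter_group gens (affA_matrix n))" for w
    proof -
      obtain u where u: "u \<in> lists gens" "w = cls u"
        using w by (auto simp: carrier_coxeter_group)
      obtain c where c: "climbing c" "coxeter_cong gens (affA_matrix n) u c"
        using climbing_cong_exists[OF u(1)] by blast
      then have "w = cls c"
        using u climbing_lists by (simp add: word_class_eq_iff)
      then show ?thesis using climb c by simp
    qed
    have "x \<otimes> ?e = (\<Sum>w\<in>Poly_Mapping.keys x. scale (Poly_Mapping.lookup x w) (hbasis w \<otimes> ?e))"
      using that e by (intro linear_expansion) (simp_all add: mult_plus_left scale_left)
    also have "\<dots> = (\<Sum>w\<in>Poly_Mapping.keys x. scale (Poly_Mapping.lookup x w) (hbasis w))"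
      using basis that by (intro sum.cong) (auto simp: carrier_eq)
    also have "\<dots> = x" by (rule hbasis_expansion[symmetric])
    finally show ?thesis .
  qed
  show ?thesis using right_unit[of \<one>] e by simp
qed

lemma T_inverse:
  assumes "s \<in> gens"
  shows "inv (affA_T n s) = scale q' (affA_T n s) + scale (q' - 1) \<one>"
proof -
  let ?T = "affA_T n s"
  have T: "?T \<in> carrier H" using T_closed assms .
  have coeff: "q' * q = 1" "q' * (q - 1) + (q' - 1) = 0"
    using q_inverse by (simp_all add: algebra_simps)
  have "scale q' (?T \<otimes> ?T) + scale (q' - 1) ?T = \<one>"
    unfolding T_square[OF assms] one_eq_basis scale_add_right scale_scale add.assoc
    by (simp only: coeff flip: scale_add_left) simp
  then show ?thesis
    using T by (intro inv_char)
      (simp_all add: plus_closed scale_closed mult_plus_left mult_plus_right scale_left scale_right)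
qed

definition leading :: "affA_gen list \<Rightarrow> (affA_gen list set \<Rightarrow>\<^sub>0 'k) \<Rightarrow> bool" where
  "leading v x \<longleftrightarrow> (\<exists>c y. c dvd 1 \<and> y \<in> shorter_span (len v) \<and> x = scale c (hbasis (cls v)) + y)"

lemma leading_one: "leading [] \<one>"
proof -
  have "0 \<in> shorter_span (len [])" using zero_closed by (simp add: shorter_span_def zero_eq)
  then show ?thesis
    unfolding leading_def by (intro exI[of _ 1] exI[of _ 0]) (simp add: one_eq_basis)
qed

lemma leading_closed: "v \<in> lists gens \<Longrightarrow> leading v x \<Longrightarrow> x \<in> carrier H"
  unfolding leading_def by (metis basis_closed plus_closed scale_closed shorter_span_closed)

lemma leading_cls: "cls v = cls w \<Longrightarrow> leading v x \<longleftrightarrow> leading w x"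
  by (simp add: leading_def)

lemma length_fall:
  "s \<in> gens \<Longrightarrow> w \<in> lists gens \<Longrightarrow> falls s (affA_perm n w) \<Longrightarrow> len w = Suc (len (s # w))"
  using length_Cons_class_falls[of s w] by simp

lemma T_mult_shorter_span:
  assumes s: "s \<in> gens" and x: "x \<in> shorter_span k"
  shows "affA_T n s \<otimes> x \<in> shorter_span (Suc k)"
proof -
  have T: "affA_T n s \<in> carrier H" using T_closed s .
  have "affA_T n s \<otimes> hbasis w \<in> shorter_span (Suc k)" if "w \<in> Poly_Mapping.keys x" for w
  proof -
    have "w \<in> carrier (coxeter_group gens (affA_matrix n))" "coxeter_length w < k"
      using that x by (auto simp: shorter_span_def carrier_eq)
    then obtain u where u: "u \<in> lists gens" "w = cls u" "len u < k"
      by (auto simp: carrier_coxeter_group)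
    have "len (s # u) < Suc k"
      using length_Cons_class_falls[OF s u(1)] u(3) by (auto split: if_splits)
    then show ?thesis
      using u s T_mult_basis[OF s u(1)]
      by (auto intro!: shorter_span_plus shorter_span_scale shorter_span_hbasis cls_closed)
  qed
  moreover have "affA_T n s \<otimes> x =
      (\<Sum>w\<in>Poly_Mapping.keys x. scale (Poly_Mapping.lookup x w) (affA_T n s \<otimes> hbasis w))"
    using T shorter_span_closed[OF x]
    by (intro linear_expansion) (simp_all add: mult_plus_right scale_right)
  ultimately show ?thesis
    by (auto intro!: shorter_span_sum shorter_span_scale)
qed

lemma leading_T:
  assumes s: "s \<in> gens" "v \<in> lists gens" "falls s (affA_perm n v)" and lead: "leading (s # v) x"
  shows "leading v (affA_T n s \<otimes> x)"
proof -
  obtain c y where x: "c dvd 1" "y \<in> shorter_span (len (s # v))"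
      "x = scale c (hbasis (cls (s # v))) + y"
    using lead unfolding leading_def by blast
  have "affA_T n s \<otimes> x = scale c (hbasis (cls v)) + affA_T n s \<otimes> y"
    unfolding x(3) using s T_closed basis_closed shorter_span_closed[OF x(2)]
    by (simp add: mult_plus_right scale_right scale_closed basis_eq_T_mult)
  moreover have "affA_T n s \<otimes> y \<in> shorter_span (len v)"
    using T_mult_shorter_span[OF s(1) x(2)] length_fall[OF s] by simp
  ultimately show ?thesis
    unfolding leading_def using x(1) by blast
qed

text \<open>
  The inverse of \<open>g_s\<close> is \<open>q' g_s + (q' - 1)\<close>. Its scalar part contributes a multiple of \<open>x\<close>, whose
  terms are all shorter than \<open>v\<close>.
\<close>

lemma leading_T_inverse:
  assumes s: "s \<in> gens" "v \<in> lists gens" "falls s (affA_perm n v)" and lead: "leading (s # v) x"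
  shows "leading v (inv (affA_T n s) \<otimes> x)"
proof -
  obtain c y where cy: "c dvd 1" "y \<in> shorter_span (len v)"
      "affA_T n s \<otimes> x = scale c (hbasis (cls v)) + y"
    using leading_T[OF assms] unfolding leading_def by blast
  have x: "x \<in> carrier H" using leading_closed[OF _ lead] s by simp
  have "x \<in> shorter_span (len v)"
  proof -
    have less: "len (s # v) < len v" using length_fall[OF s] by simp
    obtain c y where "y \<in> shorter_span (len (s # v))" "x = scale c (hbasis (cls (s # v))) + y"
      using lead unfolding leading_def by blast
    then show ?thesis
      using less s shorter_span_mono[of y "len (s # v)" "len v"]
      by (auto intro!: shorter_span_plus shorter_span_scale shorter_span_hbasis cls_closed)
  qed
  then have "scale q' y + scale (q' - 1) x \<in> shorter_span (len v)"
    using cy by (intro shorter_span_plus shorter_span_scale)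
  moreover have "inv (affA_T n s) \<otimes> x =
      scale (q' * c) (hbasis (cls v)) + (scale q' y + scale (q' - 1) x)"
    using s x cy(3) T_closed
    by (simp add: T_inverse mult_plus_left scale_left scale_closed scale_add_right scale_scale)
  moreover have "q' * c dvd 1"
    using cy(1) q_inverse by (metis dvd_def mult.commute mult_dvd_mono mult_1)
  ultimately show ?thesis
    unfolding leading_def by blast
qed

end

section \<open>Inserting a fixed residue class into affine permutations\<close>

text \<open>
  The increasing map from the integers onto the integers not divisible by \<open>p + 1\<close> that sends
  \<open>y + p * k\<close> to \<open>y + (p + 1) * k\<close> for \<open>1 \<le> y \<le> p\<close>. Conjugating with it turns an affine permutation
  of period \<open>p\<close> into one of period \<open>p + 1\<close>, which is completed by fixing the multiples of \<open>p + 1\<close>.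
\<close>

definition stretch :: "int \<Rightarrow> int \<Rightarrow> int" where
  "stretch p y = y + (y - 1) div p"

lemma stretch_shift_multiple:
  assumes "p > 0"
  shows "stretch p (y + p * k) = stretch p y + (p + 1) * k"
proof -
  have "y + p * k - 1 = (y - 1) + p * k" by simp
  then show ?thesis
    using assms by (simp only: stretch_def div_mult_self2) (simp add: algebra_simps)
qed

lemma stretch_strict_mono: "p > 0 \<Longrightarrow> stretch p y < stretch p z \<longleftrightarrow> y < z"
  using zdiv_mono1[of "y - 1" "z - 1" p] zdiv_mono1[of "z - 1" "y - 1" p]
  by (cases y z rule: linorder_cases) (auto simp: stretch_def)

lemma stretch_inj: "p > 0 \<Longrightarrow> stretch p y = stretch p z \<longleftrightarrow> y = z"
  using stretch_strict_mono[of p y z] stretch_strict_mono[of p z y] by force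

lemma stretch_window: "1 \<le> y \<Longrightarrow> y \<le> p \<Longrightarrow> stretch p y = y"
  by (simp add: stretch_def div_pos_pos_trivial)

lemma stretch_0: "p > 0 \<Longrightarrow> stretch p 0 = -1"
  by (simp add: stretch_def div_eq_minus1)

lemma stretch_Suc: "p > 0 \<Longrightarrow> stretch p (p + 1) = p + 2"
  by (simp add: stretch_def)

lemma swap_at_window:
  assumes "1 \<le> y" "y \<le> p" "1 \<le> i" "i < p"
  shows "swap_at p i y = (if y = i then i + 1 else if y = i + 1 then i else y)"
proof -
  have "\<bar>y - i\<bar> < p" "\<bar>y - i - 1\<bar> < p" using assms by linarith+
  then have "p dvd y - i \<longleftrightarrow> y = i" "p dvd y - i - 1 \<longleftrightarrow> y = i + 1"
    using dvd_small_int[of p "y - i"] dvd_small_int[of p "y - i - 1"] by auto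
  then show ?thesis by (auto simp: swap_at_def)
qed

lemma swap_at_window_end:
  assumes "1 \<le> y" "y \<le> p" "p \<ge> 2"
  shows "swap_at p p y = (if y = p then p + 1 else if y = 1 then 0 else y)"
proof -
  have "p dvd y - p \<longleftrightarrow> y = p" "p dvd y - p - 1 \<longleftrightarrow> y = 1"
    using assms dvd_small_int[of p "y - p"] dvd_small_int[of p "y - 1"]
      dvd_diff_right_iff[of p p "y - 1"]
    by (auto simp: algebra_simps)
  then show ?thesis by (auto simp: swap_at_def)
qed

lemma int_window_cases:
  fixes x p :: int
  assumes "p > 0"
  obtains y k where "x = y + p * k" "1 \<le> y" "y \<le> p"
proof (rule that[of "1 + (x - 1) mod p" "(x - 1) div p"])
  show "x = 1 + (x - 1) mod p + p * ((x - 1) div p)" by simp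
qed (use assms in simp_all, smt (verit) pos_mod_bound)

lemma stretch_swap_interior:
  assumes "1 \<le> i" "i < p"
  shows "stretch p (swap_at p i x) = swap_at (p + 1) i (stretch p x)"
proof -
  have p: "p > 0" using assms by simp
  obtain y k where y: "x = y + p * k" "1 \<le> y" "y \<le> p"
    using int_window_cases[OF p] .
  have "stretch p (swap_at p i y) = swap_at (p + 1) i (stretch p y)"
    using assms y by (simp add: swap_at_window stretch_window)
  then show ?thesis
    unfolding y(1) using p by (simp add: stretch_shift_multiple swap_at_shift_multiple)
qed

text \<open>
  The permutation of \<open>\<sigma>_n a_(n+1) \<sigma>_n\<close> (with \<open>p = n + 1\<close>): for \<open>p \<ge> 3\<close> it exchanges the
  positions \<open>p - 1\<close> and \<open>p + 1\<close>, modulo \<open>p\<close>, and leaves \<open>p\<close> in between where it is.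
\<close>

definition end_reflection :: "int \<Rightarrow> int \<Rightarrow> int" where
  "end_reflection p x = swap_at p (p - 1) (swap_at p p (swap_at p (p - 1) x))"

lemma end_reflection_shift_multiple:
  "end_reflection p (x + p * k) = end_reflection p x + p * k"
  by (simp add: end_reflection_def swap_at_shift_multiple)

lemma stretch_swap_end:
  assumes p: "p \<ge> 2"
  shows "stretch p (swap_at p p x) = end_reflection (p + 1) (stretch p x)"
proof -
  have p0: "p > 0" using p by simp
  obtain y k where y: "x = y + p * k" "1 \<le> y" "y \<le> p"
    using int_window_cases[OF p0] .
  have edge: "swap_at (p + 1) p (p + 2) = p + 2" "swap_at (p + 1) p (2 + p) = p + 2" "swap_at (p + 1) p 0 = -1"
    using p swap_at_after[of "p + 1" p] swap_at_after[of "p + 1" p, unfolded add.commute[of p 2]]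
      swap_at_shift[of "p + 1" p "-1"] swap_at_same[of "p + 1" p]
      swap_at_next[of "p + 1" p] swap_at_shift[of "p + 1" p "0"] by simp_all
  have "stretch p (swap_at p p y) = end_reflection (p + 1) y"
    using p y edge
    by (auto simp: swap_at_window_end stretch_window stretch_0 stretch_Suc end_reflection_def
        swap_at_window)
  then show ?thesis
    unfolding y(1) using p0 y(2,3)
    by (simp add: stretch_shift_multiple swap_at_shift_multiple end_reflection_shift_multiple stretch_window)
qed

lemma end_reflection_fixes: "p \<ge> 3 \<Longrightarrow> end_reflection p (p * k) = p * k"
proof -
  assume p: "p \<ge> 3"
  have "end_reflection p p = p"
    using p swap_at_next[of p "p - 1"] swap_at_same[of p "p - 1"]
    by (simp add: end_reflection_def swap_at_window_end)
  then show ?thesis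
    using end_reflection_shift_multiple[of p p "k - 1"] by (simp add: algebra_simps)
qed

lemma swap_at_interior_fixes: "1 \<le> i \<Longrightarrow> i < p - 1 \<Longrightarrow> swap_at p i (p * k) = p * k"
  using swap_at_shift_multiple[of p i p "k - 1"] swap_at_window[of p p i] by (simp add: algebra_simps)

lemma int_stretch_cases:
  assumes "p > 0"
  obtains y where "x = stretch p y" | k where "x = (p + 1) * k"
proof -
  have p1: "p + 1 > 0" using assms by simp
  obtain y k where y: "x = y + (p + 1) * k" "1 \<le> y" "y \<le> p + 1"
    using int_window_cases[OF p1] .
  show thesis
  proof (cases "y = p + 1")
    case True
    then have "x = (p + 1) * (k + 1)" using y by (simp add: algebra_simps)
    then show ?thesis using that by blast
  next
    case False
    then have "x = stretch p (y + p * k)"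
      using y assms by (simp add: stretch_shift_multiple stretch_window)
    then show ?thesis using that by blast
  qed
qed

text \<open>
  The homomorphism from rank \<open>r\<close> to rank \<open>r + 1\<close> on generators. The conjugation by \<open>\<sigma>_(r+1)\<close>
  uses that this generator is its own inverse in the group; in the Hecke algebra this need not hold.
\<close>

fun embed_gen :: "nat \<Rightarrow> affA_gen \<Rightarrow> affA_gen list" where
  "embed_gen r (Sig i) = [Sig i]"
| "embed_gen r (Aff k) = [Sig (Suc r), Aff (Suc (Suc r)), Sig (Suc r)]"

definition embed :: "nat \<Rightarrow> affA_gen list \<Rightarrow> affA_gen list" where
  "embed r w = concat (map (embed_gen r) w)"

lemma embed_Cons: "embed r (s # w) = embed_gen r s @ embed r w"
  by (simp add: embed_def)

lemma embed_lists: "w \<in> lists (affA_gens r) \<Longrightarrow> embed r w \<in> lists (affA_gens (Suc r))"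
  by (induction w) (auto simp: embed_def affA_gens_def)

locale affA_rank_step = small: affine_type_A r + large: affine_type_A "Suc r" for r :: nat
begin

abbreviation p :: int where "p \<equiv> int r + 1"

lemma p_ge_2: "p \<ge> 2"
  using small.rank_pos by simp

lemma large_period: "int (Suc r) + 1 = p + 1"
  by simp

text \<open>
  Stretching intertwines each generator with its image: this is \<open>stretch_swap_interior\<close> for \<open>\<sigma>_i\<close> and
  \<open>stretch_swap_end\<close> for the affine generator. The multiples of \<open>p + 1\<close> are fixed by both kinds of images.
\<close>

lemma affA_perm_embed:
  assumes "w \<in> lists (affA_gens r)"
  shows "affA_perm (Suc r) (embed r w) (stretch p x) = stretch p (affA_perm r w x)"
    and "affA_perm (Suc r) (embed r w) ((p + 1) * k) = (p + 1) * k"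
proof -
  have "(\<forall>x. affA_perm (Suc r) (embed r w) (stretch p x) = stretch p (affA_perm r w x)) \<and>
      (\<forall>k. affA_perm (Suc r) (embed r w) ((p + 1) * k) = (p + 1) * k)"
    using assms
  proof (induction w)
    case Nil
    show ?case
      unfolding embed_def list.map concat.simps affA_perm.simps by simp
  next
    case (Cons s w)
    then have IH: "affA_perm (Suc r) (embed r w) (stretch p x) = stretch p (affA_perm r w x)"
        "affA_perm (Suc r) (embed r w) ((p + 1) * k) = (p + 1) * k" for x k
      by auto
    from Cons have "s \<in> affA_gens r" by simp
    then consider i where "s = Sig i" "1 \<le> i" "i \<le> r" | "s = Aff (Suc r)"
      by (auto simp: affA_gens_def)
    then show ?case
    proof cases
      case 1
      have "affA_perm (Suc r) (embed r (s # w)) x = affA_perm (Suc r) (embed r w) (swap_at (p + 1) (int i) x)" for x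
        unfolding 1 embed_Cons embed_gen.simps append_Cons append_Nil affA_perm.simps comp_apply
          affA_index.simps large_period ..
      moreover have "affA_perm r (s # w) x = affA_perm r w (swap_at p (int i) x)" for x
        unfolding 1 affA_perm.simps comp_apply affA_index.simps ..
      ultimately show ?thesis
        using 1 IH stretch_swap_interior[of "int i" p, symmetric] swap_at_interior_fixes[of "int i" "p + 1"]
        by simp
    next
      case 2
      have "affA_perm (Suc r) (embed r (s # w)) x = affA_perm (Suc r) (embed r w) (end_reflection (p + 1) x)" for x
        unfolding 2 embed_Cons embed_gen.simps append_Cons append_Nil affA_perm.simps comp_apply
          affA_index.simps large_period end_reflection_def by (simp add: add.commute)
      moreover have "affA_perm r (s # w) x = affA_perm r w (swap_at p p x)" for x
        unfolding 2 affA_perm.simps comp_apply affA_index.simps by (simp add: add.commute)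
      ultimately show ?thesis
        using IH stretch_swap_end[OF p_ge_2, symmetric] end_reflection_fixes[of "p + 1"] p_ge_2
        by simp
    qed
  qed
  then show "affA_perm (Suc r) (embed r w) (stretch p x) = stretch p (affA_perm r w x)"
    "affA_perm (Suc r) (embed r w) ((p + 1) * k) = (p + 1) * k" by auto
qed

lemma affA_perm_embed_eq_iff:
  assumes "v \<in> lists (affA_gens r)" "w \<in> lists (affA_gens r)"
  shows "affA_perm (Suc r) (embed r v) = affA_perm (Suc r) (embed r w) \<longleftrightarrow> affA_perm r v = affA_perm r w"
proof
  assume eq: "affA_perm r v = affA_perm r w"
  show "affA_perm (Suc r) (embed r v) = affA_perm (Suc r) (embed r w)"
  proof
    fix x
    show "affA_perm (Suc r) (embed r v) x = affA_perm (Suc r) (embed r w) x"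
      using int_stretch_cases[of p x] p_ge_2 eq affA_perm_embed[OF assms(1)] affA_perm_embed[OF assms(2)]
      by (smt (verit))
  qed
next
  assume "affA_perm (Suc r) (embed r v) = affA_perm (Suc r) (embed r w)"
  then have "stretch p (affA_perm r v x) = stretch p (affA_perm r w x)" for x
    using affA_perm_embed(1)[OF assms(1)] affA_perm_embed(1)[OF assms(2)] by metis
  then show "affA_perm r v = affA_perm r w"
    using p_ge_2 by (simp add: stretch_inj fun_eq_iff)
qed

lemma embed_class_eq_iff:
  assumes "v \<in> lists (affA_gens r)" "w \<in> lists (affA_gens r)"
  shows "word_class (affA_gens (Suc r)) (affA_matrix (Suc r)) (embed r v) =
      word_class (affA_gens (Suc r)) (affA_matrix (Suc r)) (embed r w) \<longleftrightarrow>
    word_class (affA_gens r) (affA_matrix r) v = word_class (affA_gens r) (affA_matrix r) w"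
  using assms affA_perm_embed_eq_iff[OF assms]
  by (simp only: embed_lists small.word_class_eq_iff_affA_perm large.word_class_eq_iff_affA_perm)

lemma falls_embed_Sig:
  assumes "w \<in> lists (affA_gens r)" "1 \<le> i" "i \<le> r"
  shows "falls (Sig i) (affA_perm (Suc r) (embed r w)) \<longleftrightarrow> falls (Sig i) (affA_perm r w)"
proof -
  have "stretch p (int i) = int i" "stretch p (int i + 1) = int i + 1"
    using assms by (simp_all add: stretch_window)
  then have "affA_perm (Suc r) (embed r w) (int i) = stretch p (affA_perm r w (int i))"
    "affA_perm (Suc r) (embed r w) (int i + 1) = stretch p (affA_perm r w (int i + 1))"
    using affA_perm_embed(1)[OF assms(1)] by metis+
  then show ?thesis
    using stretch_strict_mono[of p] by (simp add: falls_def drop_at_def)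
qed

text \<open>
  The crucial point. Let \<open>u\<close> be the permutation of \<open>w\<close>, with period \<open>p\<close>, and suppose that it increases on
  the window \<open>{1..p}\<close> without being the identity. Then \<open>u 1 \<le> 0\<close> and \<open>u p \<ge> p + 1\<close>, so the
  stretched permutation \<open>U\<close> has \<open>U 1 \<le> -1\<close> and \<open>U p \<ge> p + 2\<close>. At the positions \<open>p\<close>, \<open>p + 1\<close>, \<open>p + 2\<close> its values are \<open>U p\<close>, \<open>p + 1\<close>,
  \<open>U 1 + p + 1\<close>, which is a strictly decreasing sequence. Sorting it takes three descents.
\<close>

lemma minimal_coset_falls:
  assumes w: "w \<in> lists (affA_gens r)" "affA_perm r w \<noteq> id"
    and min: "\<And>i. 1 \<le> i \<Longrightarrow> i \<le> r \<Longrightarrow> \<not> falls (Sig i) (affA_perm r w)"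
  defines "v \<equiv> embed r w" and "s \<equiv> Sig (Suc r)" and "a \<equiv> Aff (Suc (Suc r))"
  shows "falls (Aff (Suc r)) (affA_perm r w)"
    and "falls s (affA_perm (Suc r) v)" "falls a (affA_perm (Suc r) (s # v))"
      "falls s (affA_perm (Suc r) (a # s # v))"
proof -
  let ?u = "affA_perm r w" and ?U = "affA_perm (Suc r) v"
  have u: "?u \<in> affine_perms p" using small.affA_perm_affine[OF w(1)] .
  have U: "?U \<in> affine_perms (p + 1)"
    using large.affA_perm_affine[OF embed_lists[OF w(1)]] by (simp add: v_def algebra_simps)
  have nodrop: "\<not> drop_at x ?u" if "1 \<le> x" "x < p" for x
    using min[of "nat x"] that by (simp add: falls_def)
  have ends: "?u 1 \<le> 0" "?u p \<ge> p + 1"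
    using increasing_affine_perm[OF _ u w(2)] nodrop by simp_all
  have "?u (p + 1) = ?u 1 + p" using affine_perms_shift[OF u, of 1] by (simp add: add.commute)
  then show "falls (Aff (Suc r)) ?u" using ends by (simp add: falls_def drop_at_def add.commute)
  have "stretch p 1 = 1" "stretch p p = p" using p_ge_2 by (simp_all add: stretch_window)
  then have "?U 1 = stretch p (?u 1)" "?U p = stretch p (?u p)"
    using affA_perm_embed(1)[OF w(1)] unfolding v_def by metis+
  then have U_ends: "?U 1 \<le> -1" "?U p \<ge> p + 2"
    using ends stretch_strict_mono[of p] stretch_0[of p] stretch_Suc[of p] p_ge_2
    by (smt (verit))+
  have U_mid: "?U (p + 1) = p + 1"
    using affA_perm_embed(2)[OF w(1), of 1] by (simp add: v_def)
  have U_next: "?U (p + 2) = ?U 1 + p + 1"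
    using affine_perms_shift[OF U, of 1] by (simp add: algebra_simps)
  have idx: "affA_index s = p" "affA_index a = p + 1" by (simp_all add: s_def a_def)
  show "falls s ?U"
    using U_ends U_mid by (simp only: falls_def idx drop_at_def)
  have s_at: "swap_at (p + 1) p p = p + 1" "swap_at (p + 1) p (p + 1) = p"
      "swap_at (p + 1) p (p + 2) = p + 2"
    using p_ge_2 by (simp_all only: swap_at_same swap_at_next swap_at_after)
  have a_at: "swap_at (p + 1) (p + 1) p = p" "swap_at (p + 1) (p + 1) (p + 1) = p + 2"
    using p_ge_2 by (simp_all only: swap_at_before swap_at_first)
  have sv: "affA_perm (Suc r) (s # v) = ?U \<circ> swap_at (p + 1) p"
    by (simp only: affA_perm.simps idx large_period)
  have asv: "affA_perm (Suc r) (a # s # v) = ?U \<circ> swap_at (p + 1) p \<circ> swap_at (p + 1) (p + 1)"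
    by (simp only: affA_perm.simps idx large_period)
  show "falls a (affA_perm (Suc r) (s # v))"
    using U_ends U_next unfolding sv falls_def idx drop_at_next by (simp only: comp_apply s_at)
  show "falls s (affA_perm (Suc r) (a # s # v))"
    using U_ends U_mid U_next unfolding asv falls_def idx drop_at_def
    by (simp only: comp_apply s_at a_at)
qed

end

section \<open>Triangularity and injectivity\<close>

locale affA_tower_map =
  small: affA_hecke r q H q' + large: affA_hecke "Suc r" q H' q'
  for r :: nat and q q' :: "'k::comm_ring_1"
    and H H' :: "(affA_gen list set \<Rightarrow>\<^sub>0 'k) ring" +
  fixes h :: "(affA_gen list set \<Rightarrow>\<^sub>0 'k) \<Rightarrow> (affA_gen list set \<Rightarrow>\<^sub>0 'k)"
  assumes is_HR: "is_HR (Suc r) H H' h"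
begin

sublocale affA_rank_step r ..

lemma h_hom: "h \<in> ring_hom H H'"
  and h_scale: "x \<in> carrier H \<Longrightarrow> h (scale c x) = scale c (h x)"
  using is_HR by (auto simp: is_HR_def algebra_hom_def)

lemma h_Sig: "1 \<le> i \<Longrightarrow> i \<le> r \<Longrightarrow> h (affA_T r (Sig i)) = affA_T (Suc r) (Sig i)"
  using is_HR by (simp add: is_HR_def)

lemma h_Aff: "h (affA_T r (Aff (Suc r))) = affA_T (Suc r) (Sig (Suc r)) \<otimes>\<^bsub>H'\<^esub>
    affA_T (Suc r) (Aff (Suc (Suc r))) \<otimes>\<^bsub>H'\<^esub> inv\<^bsub>H'\<^esub> affA_T (Suc r) (Sig (Suc r))"
  using is_HR by (simp add: is_HR_def)

lemma h_plus: "x \<in> carrier H \<Longrightarrow> y \<in> carrier H \<Longrightarrow> h (x + y) = h x + h y"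
  using ring_hom_add[OF h_hom, of x y] ring_hom_closed[OF h_hom]
  by (simp add: small.add_eq large.add_eq)

text \<open>
  Triangularity of the algebra map over the group embedding, by induction on the height of the
  permutation of \<open>w\<close>. A descent \<open>\<sigma>_i\<close> is stripped if there is one. Otherwise \<open>w\<close> is the shortest element
  of its coset \<open>F w\<close>, where \<open>F\<close> is the finite group generated by \<open>\<sigma>_1, ..., \<sigma>_r\<close>, and either it is the
  identity or the affine generator can be stripped with all three letters of its image lengthening the
  leading term.
\<close>

lemma leading_h_basis:
  assumes "w \<in> lists (affA_gens r)"
  shows "large.leading (embed r w) (h (hbasis (small.cls w)))"
  using assms
proof (induction "height p (affA_perm r w)" arbitrary: w rule: less_induct)
  case less
  note w = less.prems
  note W = embed_lists[OF w]
  have factor: "h (hbasis (small.cls w)) = h (affA_T r s) \<otimes>\<^bsub>H'\<^esub> h (hbasis (small.cls (s # w)))"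
      "large.leading (embed r (s # w)) (h (hbasis (small.cls (s # w))))"
    if s: "s \<in> affA_gens r" "falls s (affA_perm r w)" for s
  proof -
    have "height p (affA_perm r (s # w)) < height p (affA_perm r w)"
      using small.height_affA_perm_Cons s w by blast
    then show "large.leading (embed r (s # w)) (h (hbasis (small.cls (s # w))))"
      using less.hyps s w by simp
    show "h (hbasis (small.cls w)) = h (affA_T r s) \<otimes>\<^bsub>H'\<^esub> h (hbasis (small.cls (s # w)))"
      using small.basis_eq_T_mult[OF s(1) w s(2)] ring_hom_mult[OF h_hom]
        small.T_closed[OF s(1)] small.basis_closed[of "s # w"] s w by simp
  qed
  consider (finite) i where "1 \<le> i" "i \<le> r" "falls (Sig i) (affA_perm r w)"
    | (one) "affA_perm r w = id"
    | (affine) "affA_perm r w \<noteq> id"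
        "\<And>i. 1 \<le> i \<Longrightarrow> i \<le> r \<Longrightarrow> \<not> falls (Sig i) (affA_perm r w)"
    by blast
  then show ?case
  proof cases
    case finite
    let ?s = "Sig i"
    have s: "?s \<in> affA_gens r" "?s \<in> affA_gens (Suc r)"
      using finite by (auto simp: affA_gens_def)
    have "large.leading (?s # embed r w) (h (hbasis (small.cls (?s # w))))"
      using factor(2)[OF s(1) finite(3)] by (simp add: embed_Cons)
    then have "large.leading (embed r w)
        (affA_T (Suc r) ?s \<otimes>\<^bsub>H'\<^esub> h (hbasis (small.cls (?s # w))))"
      using falls_embed_Sig[OF w] finite s W by (intro large.leading_T) auto
    then show ?thesis
      using factor(1)[OF s(1) finite(3)] h_Sig finite by simp
  next
    case one
    have "small.cls w = small.cls []" "large.cls (embed r w) = large.cls (embed r [])"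
      using one w small.word_class_eq_iff_affA_perm[of w "[]"] embed_class_eq_iff[of w "[]"]
      by simp_all
    moreover have "h (hbasis (small.cls [])) = \<one>\<^bsub>H'\<^esub>"
      unfolding small.one_eq_basis using ring_hom_one[OF h_hom] .
    ultimately show ?thesis
      using large.leading_one large.leading_cls[of "embed r w" "[]"] by (simp add: embed_def)
  next
    case affine
    let ?s = "Sig (Suc r)" and ?a = "Aff (Suc (Suc r))" and ?b = "Aff (Suc r)"
    note falls = minimal_coset_falls[OF w affine]
    have gens: "?b \<in> affA_gens r" "?s \<in> affA_gens (Suc r)" "?a \<in> affA_gens (Suc r)"
      by (auto simp: affA_gens_def)
    define x where "x = h (hbasis (small.cls (?b # w)))"
    let ?S = "affA_T (Suc r) ?s" and ?A = "affA_T (Suc r) ?a"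
    have lists: "?s # embed r w \<in> lists (affA_gens (Suc r))"
        "?a # ?s # embed r w \<in> lists (affA_gens (Suc r))"
      using W gens by simp_all
    have x0: "large.leading (?s # ?a # ?s # embed r w) x"
      using factor(2)[OF gens(1) falls(1)] by (simp add: x_def embed_Cons)
    have x1: "large.leading (?a # ?s # embed r w) (inv\<^bsub>H'\<^esub> ?S \<otimes>\<^bsub>H'\<^esub> x)"
      using large.leading_T_inverse[OF gens(2) lists(2) falls(4) x0] .
    have x2: "large.leading (?s # embed r w) (?A \<otimes>\<^bsub>H'\<^esub> (inv\<^bsub>H'\<^esub> ?S \<otimes>\<^bsub>H'\<^esub> x))"
      using large.leading_T[OF gens(3) lists(1) falls(3) x1] .
    have x3: "large.leading (embed r w) (?S \<otimes>\<^bsub>H'\<^esub> (?A \<otimes>\<^bsub>H'\<^esub> (inv\<^bsub>H'\<^esub> ?S \<otimes>\<^bsub>H'\<^esub> x)))"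
      using large.leading_T[OF gens(2) W falls(2) x2] .
    have closed: "x \<in> carrier H'" "?S \<in> carrier H'" "?A \<in> carrier H'" "inv\<^bsub>H'\<^esub> ?S \<in> carrier H'"
      using large.leading_closed[OF _ x0] gens W large.T_closed
      by (simp_all add: large.T_inverse large.plus_closed large.scale_closed)
    have "h (hbasis (small.cls w)) = ?S \<otimes>\<^bsub>H'\<^esub> ?A \<otimes>\<^bsub>H'\<^esub> inv\<^bsub>H'\<^esub> ?S \<otimes>\<^bsub>H'\<^esub> x"
      using factor(1)[OF gens(1) falls(1)] unfolding h_Aff x_def .
    then show ?thesis
      using x3 closed by (simp add: large.m_assoc)
  qed
qed

text \<open>
  Look at a basis element in the support of \<open>x\<close> whose image has the longest leading word. No other
  element of the support contributes to that coefficient of \<open>h x\<close>: leading terms of the same length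
  differ because the embedding is injective, and the remaining terms are shorter.
\<close>

lemma h_eq_zero_imp_zero:
  assumes x: "x \<in> carrier H" and hx: "h x = 0"
  shows "x = 0"
proof (rule ccontr)
  let ?K = "Poly_Mapping.keys x"
  define word where "word v = (SOME w. w \<in> lists (affA_gens r) \<and> small.cls w = v)" for v
  define top where "top v = large.cls (embed r (word v))" for v
  have word: "word v \<in> lists (affA_gens r)" "small.cls (word v) = v" if "v \<in> ?K" for v
  proof -
    have "\<exists>w. w \<in> lists (affA_gens r) \<and> small.cls w = v"
      using x that by (auto simp: small.carrier_eq carrier_coxeter_group)
    from someI_ex[OF this] show "word v \<in> lists (affA_gens r)" "small.cls (word v) = v"
      by (simp_all add: word_def)
  qed
  have top_inj: "top v = top w \<longleftrightarrow> v = w" if "v \<in> ?K" "w \<in> ?K" for v w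
    using word[OF that(1)] word[OF that(2)] by (simp add: top_def embed_class_eq_iff)
  assume "x \<noteq> 0"
  then have "?K \<noteq> {}" by simp
  then have "Max ((\<lambda>w. coxeter_length (top w)) ` ?K) \<in> (\<lambda>w. coxeter_length (top w)) ` ?K"
    by (intro Max_in) auto
  then obtain v where "v \<in> ?K" "coxeter_length (top v) = Max ((\<lambda>w. coxeter_length (top w)) ` ?K)"
    by auto
  then have v: "v \<in> ?K" "\<And>w. w \<in> ?K \<Longrightarrow> coxeter_length (top w) \<le> coxeter_length (top v)"
    by simp_all
  have others: "Poly_Mapping.lookup (h (hbasis w)) (top v) = 0" if w: "w \<in> ?K" "w \<noteq> v" for w
  proof -
    obtain c y where y: "y \<in> large.shorter_span (coxeter_length (top w))"
        "h (hbasis w) = scale c (hbasis (top w)) + y"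
      using leading_h_basis[OF word(1)[OF w(1)]] word(2)[OF w(1)]
      unfolding large.leading_def top_def by auto
    then have "top v \<notin> Poly_Mapping.keys y"
      using v(2)[OF w(1)] by (auto simp: large.shorter_span_def)
    moreover have "top w \<noteq> top v" using top_inj w v(1) by blast
    ultimately show ?thesis
      using y(2) by (simp add: lookup_add lookup_scale lookup_hbasis in_keys_iff)
  qed
  obtain c y where y: "c dvd 1" "y \<in> large.shorter_span (coxeter_length (top v))"
      "h (hbasis v) = scale c (hbasis (top v)) + y"
    using leading_h_basis[OF word(1)[OF v(1)]] word(2)[OF v(1)]
    unfolding large.leading_def top_def by auto
  then have "top v \<notin> Poly_Mapping.keys y" by (auto simp: large.shorter_span_def)
  then have top: "Poly_Mapping.lookup (h (hbasis v)) (top v) = c"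
    using y(3) by (simp add: lookup_add lookup_scale lookup_hbasis in_keys_iff)
  have "0 = Poly_Mapping.lookup (h x) (top v)" using hx by simp
  also have "h x = (\<Sum>w\<in>?K. scale (Poly_Mapping.lookup x w) (h (hbasis w)))"
    using x by (intro small.linear_expansion h_plus h_scale)
  also have "Poly_Mapping.lookup \<dots> (top v) =
      (\<Sum>w\<in>?K. Poly_Mapping.lookup x w * Poly_Mapping.lookup (h (hbasis w)) (top v))"
    by (simp add: lookup_sum lookup_scale)
  also have "\<dots> = (\<Sum>w\<in>?K. if w = v then Poly_Mapping.lookup x v * c else 0)"
    using others top by (intro sum.cong) auto
  also have "\<dots> = Poly_Mapping.lookup x v * c"
    using v(1) by simp
  finally have "Poly_Mapping.lookup x v * c = 0" ..
  moreover obtain d where "c * d = 1" using y(1) by (metis dvdE)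
  ultimately have "Poly_Mapping.lookup x v = 0"
    by (metis mult.assoc mult.right_neutral mult_zero_left)
  then show False using v(1) by (simp add: in_keys_iff)
qed

lemma h_injective: "inj_on h (carrier H)"
proof (rule inj_onI)
  fix x y assume xy: "x \<in> carrier H" "y \<in> carrier H" "h x = h y"
  have neg: "scale (-1) z = - z" for z :: "affA_gen list set \<Rightarrow>\<^sub>0 'k"
    by (rule poly_mapping_eqI) (simp add: lookup_scale)
  have y: "scale (-1) y \<in> carrier H"
    using small.scale_closed xy(2) .
  have "h (x + scale (-1) y) = h x + scale (-1) (h y)"
    by (simp only: h_plus[OF xy(1) y] h_scale[OF xy(2)])
  then have "h (x + scale (-1) y) = 0"
    unfolding xy(3) neg by simp
  then have "x + scale (-1) y = 0"
    using h_eq_zero_imp_zero[OF small.plus_closed[OF xy(1) y]] by blast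
  then show "x = y" by (simp add: neg)
qed

end

theorem corollary4p9:
  fixes q :: "'k::comm_ring_1"
    and n :: nat
    and H H' :: "(affA_gen list set \<Rightarrow>\<^sub>0 'k) ring"
    and HR :: "(affA_gen list set \<Rightarrow>\<^sub>0 'k) \<Rightarrow> (affA_gen list set \<Rightarrow>\<^sub>0 'k)"
  assumes "q dvd 1"
    and "n \<ge> 2"
    and "affA_hecke_algebra (n - 1) q H"
    and "affA_hecke_algebra n q H'"
    and "is_HR n H H' HR"
  shows "inj_on HR (carrier H)"
proof -
  \<comment> \<open>Words and periods of the two groups are compared in terms of the smaller rank.\<close>
  obtain r where n: "n = Suc r" "r \<ge> 1"
    using assms(2) by (cases n) auto
  obtain q' where q': "q * q' = 1"
    using assms(1) by (metis dvdE)
  interpret small: affA_hecke_algebra r q H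
    using assms(3) n by simp
  interpret large: affA_hecke_algebra "Suc r" q H'
    using assms(4) n by simp
  interpret affA_tower_map r q q' H H' HR
    by unfold_locales (use n q' assms(5) in auto)
  show ?thesis
    by (rule h_injective)
qed

end
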